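(* Let $k>0$ be fixed and define polynomials $B_n^{(k)}(x)$ by $$\sum_{n\ge 0}B_n^{(k)}(x)\frac{z^n}{n!}=\left(\frac{(1-x)e^{kz(1-x)}}{1-xe^{2kz(1-x)}}\right)^{1/k}.$$ Then: (i) For $n\geq 1$, $B_n^{(k)}(x)=\sum_{w\in B_n}x^{\mathrm{wexc}(w)}k^{n-\mathrm{cyc}(w)}$. (ii) The polynomials satisfy $B_{n+1}^{(k)}(x)=(1+x+2knx)B_n^{(k)}(x)+2kx(1-x)\frac{d}{dx}B_n^{(k)}(x)$, with $B_0^{(k)}(x)=1$ and $B_1^{(k)}(x)=1+x$. (iii) $B_n^{(k)}(x)$ is $\gamma$-positive; more precisely, for $n\ge 1$, $$B_n^{(k)}(x)=\sum_{i=0}^{\lfloor n/2\rfloor}\left(\sum_{j=i}^{n-1}b(n,i,j)k^j4^i\right)x^i(1+x)^{n-2i},$$ where the integers $b(n,i,j)$ ($n\ge1$) are defined by $b(1,0,0)=1$, $b(1,i,j)=0$ for $(i,j)\neq(0,0)$, $b(n,i,j)=0$ whenever $i<0$ or $j<0$, and $$b(n+1,i,j)=b(n,i,j)+2i\,b(n,i,j-1)+(n-2i+2)\,b(n,i-1,j-1).$$ (iv) Setting $b_n(x,q)=\sum_{i=0}^{\lfloor n/2\rfloor}\sum_{j=i}^{n-1}b(n,i,j)x^iq^j$ for $n\ge1$ and $b_0(x,q)=1$, we have $b_n(x,q)=\sum_{\pi\in\mathfrak{S}_n}x^{\mathrm{cpk}(\pi)}q^{n-\mathrm{cyc}(\pi)}$,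 and $$\sum_{n\ge 0}b_n(x,q)\frac{z^n}{n!}=\left(\frac{\sqrt{1-x}}{\sqrt{1-x}\cosh(qz\sqrt{1-x})-\sinh(qz\sqrt{1-x})}\right)^{1/q}.$$
   Context: $B_n$ is the hyperoctahedral group of signed permutations $w$ of $\pm[n]=\{\pm1,\dots,\pm n\}$ with $w(-i)=-w(i)$. Elements are written in standard cycle decomposition: each cycle starts with its element of largest absolute value, cycles ordered by increasing absolute value of their first elements; $\mathrm{cyc}(w)$ is the number of cycles. An index $i\in[n]$ is a weak excedance of $w$ if $w(i)=i$ or $w(|w(i)|)>w(i)$; $\mathrm{wexc}(w)$ is their number. $\mathfrak{S}_n$ is the symmetric group on $[n]$; $\mathrm{cyc}(\pi)$ is its number of cycles, and a cycle peak of $\pi$ is an $i$ with $\pi^{-1}(i)<i>\pi(i)$; $\mathrm{cpk}(\pi)$ is the number of cycle peaks. A symmetric polynomial $f(x)=\sum_{i=0}^n f_ix^i$ (with $f_i=f_{n-i}$) is $\gamma$-positive if in its unique expansion $f(x)=\sum_{i=0}^{\lfloor n/2\rfloor}\gamma_ix^i(1+x)^{n-2i}$ all $\gamma_i\ge 0$. *)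

theory Defs
  imports "HOL-Analysis.Analysis" "HOL-Computational_Algebra.Computational_Algebra"
    "HOL-Combinatorics.Orbits"
begin

(* F^a for a formal power series F with constant term 1, via the binomial series:
   F^a = (1 + (F - 1))^a = sum_m (a choose m) (F - 1)^m *)
definition fps_powc :: "'a::field_char_0 fps \<Rightarrow> 'a \<Rightarrow> 'a fps" where
  "fps_powc F a = fps_binomial a oo (F - 1)"

definition B_egf :: "real \<Rightarrow> real poly fract fps" where
  "B_egf k = (let x = to_fract [:0, 1:]; c = to_fract [:k:] * (1 - x) in
     fps_powc (fps_const (1 - x) * fps_exp c / (1 - fps_const x * fps_exp (2 * c)))
              (1 / to_fract [:k:]))"

definition Bk :: "real \<Rightarrow> nat \<Rightarrow> real poly fract" where
  "Bk k n = fact n * (B_egf k $ n)"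

definition signed_perms :: "nat \<Rightarrow> (int \<Rightarrow> int) set" where
  "signed_perms n = {w. w permutes ({- int n..int n} - {0}) \<and> (\<forall>i. w (- i) = - w i)}"

definition num_cycles :: "('a \<Rightarrow> 'a) \<Rightarrow> 'a set \<Rightarrow> nat" where
  "num_cycles f S = card ((\<lambda>x. orbit f x) ` S)"

(* cyc(w) for signed permutations: the cycles of the standard cycle decomposition
   are the cycles of |w| on [n] (with signs attached) *)
definition cycB :: "nat \<Rightarrow> (int \<Rightarrow> int) \<Rightarrow> nat" where
  "cycB n w = num_cycles (\<lambda>i. \<bar>w i\<bar>) {1..int n}"

definition wexc :: "nat \<Rightarrow> (int \<Rightarrow> int) \<Rightarrow> nat" where
  "wexc n w = card {i \<in> {1..int n}. w i = i \<or> w \<bar>w i\<bar> > w i}"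

definition cycS :: "nat \<Rightarrow> (nat \<Rightarrow> nat) \<Rightarrow> nat" where
  "cycS n \<pi> = num_cycles \<pi> {1..n}"

definition cpk :: "nat \<Rightarrow> (nat \<Rightarrow> nat) \<Rightarrow> nat" where
  "cpk n \<pi> = card {i \<in> {1..n}. inv \<pi> i < i \<and> i > \<pi> i}"

(* the integers b(n,i,j), n \<ge> 1 (the value at n = 0 is an unused junk value) *)
fun bcoef :: "nat \<Rightarrow> int \<Rightarrow> int \<Rightarrow> int" where
  "bcoef 0 i j = 0"
| "bcoef (Suc 0) i j = (if i = 0 \<and> j = 0 then 1 else 0)"
| "bcoef (Suc (Suc m)) i j = (if i < 0 \<or> j < 0 then 0 else
     bcoef (Suc m) i j + 2 * i * bcoef (Suc m) i (j - 1)
     + (int (Suc m) - 2 * i + 2) * bcoef (Suc m) (i - 1) (j - 1))"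

definition bpoly :: "nat \<Rightarrow> 'a::comm_ring_1 \<Rightarrow> 'a \<Rightarrow> 'a" where
  "bpoly n x q = (if n = 0 then 1 else
     (\<Sum>i = 0..n div 2. \<Sum>j = i..n - 1. of_int (bcoef n (int i) (int j)) * x ^ i * q ^ j))"

definition gamma_positive :: "nat \<Rightarrow> real poly \<Rightarrow> bool" where
  "gamma_positive n f \<longleftrightarrow> (\<exists>\<gamma>. (\<forall>i. 0 \<le> \<gamma> i) \<and>
     f = (\<Sum>i = 0..n div 2. smult (\<gamma> i) ([:0, 1:] ^ i * [:1, 1:] ^ (n - 2 * i))))"

(* (sqrt(1-x) / (sqrt(1-x) cosh(qz sqrt(1-x)) - sinh(qz sqrt(1-x))))^{1/q} as a formal
   power series in z, for complex parameters x \<noteq> 1, q \<noteq> 0 *)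
definition b_egf_rhs :: "complex \<Rightarrow> complex \<Rightarrow> complex fps" where
  "b_egf_rhs x q = (let s = csqrt (1 - x); c = q * s;
     ch = fps_const (1/2) * (fps_exp c + fps_exp (- c));
     sh = fps_const (1/2) * (fps_exp c - fps_exp (- c)) in
     fps_powc (fps_const s / (fps_const s * ch - sh)) (1 / q))"

end

theory Submission
  imports Defs
begin

text \<open>
  Let \<open>b\<^sub>n(x)\<close> satisfy \<open>b\<^sub>n\<^sub>+\<^sub>1 = (1 + nqx) b\<^sub>n + 2qx(1 - x) b\<^sub>n'\<close>. Inserting \<open>n + 1\<close> into the
  cycles of a permutation shows that these are the cycle peak polynomials, and comparing
  coefficients that their coefficients are the sums over \<open>b(n,i,j) q^j\<close>.

  For the generating function, put \<open>T = (1 - qxz) \<partial>\<^sub>z - 2qx(1 - x) \<partial>\<^sub>x\<close>. The recurrence says \<open>T F = F\<close>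
  for the exponential generating function \<open>F\<close>, while \<open>D = cosh(qsz) - sinh(qsz) / s\<close> with
  \<open>x = 1 - s^2\<close> satisfies \<open>T D = -q D\<close>. As \<open>T\<close> is a derivation and \<open>T \<partial>\<^sub>z = \<partial>\<^sub>z T + qx \<partial>\<^sub>z\<close>, the
  series \<open>V = D \<partial>\<^sub>z F + (1/q) F \<partial>\<^sub>z D\<close> satisfies \<open>T V = (1 + qx - q) V\<close>; its constant term is zero,
  so \<open>V = 0\<close>, which means \<open>F = D^(-1/q)\<close>.

  The substitution \<open>x \<mapsto> 4x / (1 + x)^2\<close>, \<open>z \<mapsto> (1 + x) z\<close>, for which \<open>s = (1 - x) / (1 + x)\<close>, turns
  \<open>F\<close> into the generating function of the \<open>B\<^sub>n\<close>, which is the gamma expansion. Its recurrence is also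
  that of the weak excedance polynomials of signed permutations under insertion of \<open>\<plusminus>(n + 1)\<close>.
\<close>

section \<open>Cycle peak polynomials and the gamma expansion\<close>

lemma pderiv_sum: "pderiv (sum f A) = (\<Sum>i\<in>A. pderiv (f i :: 'a::idom poly))"
  by (induction A rule: infinite_finite_induct) (simp_all add: pderiv_add)

lemma smult_sum_right: "smult c (sum f A) = (\<Sum>i\<in>A. smult c (f i))"
  by (induction A rule: infinite_finite_induct) (simp_all add: smult_add_right)

text \<open>The recurrence serves as the definition; the integers \<open>bcoef\<close>, the
  generating function and the cycle peak statistic are each matched to it separately.\<close>

fun cpk_poly :: "'a::field_char_0 \<Rightarrow> nat \<Rightarrow> 'a poly" where
  "cpk_poly q 0 = 1"
| "cpk_poly q (Suc n) = [:1, of_nat n * q:] * cpk_poly q n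
     + smult (2 * q) ([:0, 1:] * [:1, -1:] * pderiv (cpk_poly q n))"

lemma coeff_cpk_poly_0: "coeff (cpk_poly q n) 0 = 1"
  by (induction n) (simp_all add: coeff_mult)

lemma coeff_cpk_poly_Suc:
  "coeff (cpk_poly q (Suc n)) (Suc i) =
     (1 + 2 * q * of_nat (Suc i)) * coeff (cpk_poly q n) (Suc i)
     + q * (of_nat n - 2 * of_nat i) * coeff (cpk_poly q n) i"
  by (cases i) (simp_all add: coeff_pderiv algebra_simps)

text \<open>A step of the recurrence that raises \<open>i\<close> also raises \<open>j\<close>, and
  \<open>j\<close> grows by at most one per step. This support allows summation ranges to be changed
  freely.\<close>

lemma bcoef_eq_0: "i < 0 \<or> j < 0 \<or> j < i \<or> int n \<le> j \<Longrightarrow> bcoef n i j = 0"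
  by (induction n i j rule: bcoef.induct) auto

text \<open>For negative \<open>i\<close> or \<open>j\<close> every term on the right vanishes, in
  agreement with the guard in \<open>bcoef\<close>.\<close>

lemma bcoef_Suc:
  assumes "n \<ge> 1"
  shows "bcoef (Suc n) i j = bcoef n i j + 2 * i * bcoef n i (j - 1)
           + (int n - 2 * i + 2) * bcoef n (i - 1) (j - 1)"
  using assms by (cases n) (auto simp: bcoef_eq_0)

lemma coeff_cpk_poly_bcoef:
  fixes q :: "'a::field_char_0"
  assumes "n \<ge> 1"
  shows "coeff (cpk_poly q n) i = (\<Sum>j=i..n - 1. of_int (bcoef n (int i) (int j)) * q ^ j)"
proof -
  \<comment> \<open>A range \<open>j \<le> n\<close> independent of \<open>i\<close> and an integer
    index \<open>i\<close> make the shift in \<open>j\<close> uniform and give meaning to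
    \<open>i - 1\<close> at \<open>i = 0\<close>.\<close>
  define G where "G = (\<lambda>n i. \<Sum>j\<le>n. of_int (bcoef n i (int j)) * q ^ j)"
  have shift: "(\<Sum>j\<le>Suc n. of_int (bcoef n i (int j - 1)) * q ^ j) = q * G n i" for n i
    by (subst sum.atMost_Suc_shift) (simp add: G_def bcoef_eq_0 sum_distrib_left mult_ac)
  have G_Suc: "G (Suc n) i = G n i + 2 * of_int i * q * G n i
                 + (of_nat n - 2 * of_int i + 2) * q * G n (i - 1)" if "n \<ge> 1" for n i
  proof -
    have "G (Suc n) i = (\<Sum>j\<le>Suc n. of_int (bcoef n i (int j)) * q ^ j)
        + 2 * of_int i * (\<Sum>j\<le>Suc n. of_int (bcoef n i (int j - 1)) * q ^ j)
        + (of_nat n - 2 * of_int i + 2) * (\<Sum>j\<le>Suc n. of_int (bcoef n (i - 1) (int j - 1)) * q ^ j)"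
      unfolding G_def bcoef_Suc[OF that] sum_distrib_left sum.distrib[symmetric]
      by (intro sum.cong refl) (simp add: algebra_simps)
    also have "(\<Sum>j\<le>Suc n. of_int (bcoef n i (int j)) * q ^ j) = G n i"
      by (simp add: G_def bcoef_eq_0)
    finally show ?thesis unfolding shift by (simp add: mult.assoc)
  qed
  have "coeff (cpk_poly q n) i = G n (int i)" using assms
  proof (induction n arbitrary: i rule: nat_induct_at_least)
    case base
    have "[:1::'a:] = 1" by simp
    then show ?case by (cases i) (simp_all add: G_def)
  next
    case (Suc n)
    show ?case
    proof (cases i)
      case 0
      have "G n (-1) = 0" by (simp add: G_def bcoef_eq_0)
      with 0 Suc.IH[of 0] Suc.hyps show ?thesis
        by (simp only: coeff_cpk_poly_0 G_Suc) simp
    next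
      case (Suc m)
      show ?thesis
        by (simp only: Suc coeff_cpk_poly_Suc Suc.IH G_Suc[OF Suc.hyps])
           (simp add: algebra_simps)
    qed
  qed
  also have "G n (int i) = (\<Sum>j=i..n - 1. of_int (bcoef n (int i) (int j)) * q ^ j)"
    unfolding G_def
  proof (rule sum.mono_neutral_right)
    show "\<forall>j\<in>{..n} - {i..n - 1}. of_int (bcoef n (int i) (int j)) * q ^ j = 0"
    proof
      fix j assume "j \<in> {..n} - {i..n - 1}"
      then have "j < i \<or> n \<le> j" using assms by auto
      then show "of_int (bcoef n (int i) (int j)) * q ^ j = 0" by (simp add: bcoef_eq_0)
    qed
  qed (use assms in auto)
  finally show ?thesis .
qed

text \<open>Index \<open>m\<close> feeds index \<open>m + 1\<close> with the factor
  \<open>n - 2m\<close>, which is zero exactly at \<open>n = 2m\<close>, where the degree bound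
  could otherwise be exceeded.\<close>

lemma coeff_cpk_poly_eq_0: "n < 2 * i \<Longrightarrow> coeff (cpk_poly q n) i = 0"
proof (induction n arbitrary: i)
  case 0
  then show ?case by (simp add: coeff_eq_0)
next
  case (Suc n)
  then obtain m where m: "i = Suc m" by (cases i) auto
  have "n = 2 * m \<or> coeff (cpk_poly q n) m = 0" using Suc.IH[of m] Suc.prems m by linarith
  moreover have "coeff (cpk_poly q n) (Suc m) = 0" using Suc m by auto
  ultimately show ?case unfolding m coeff_cpk_poly_Suc by auto
qed

lemma degree_cpk_poly: "degree (cpk_poly q n) \<le> n div 2"
  by (rule degree_le) (auto intro!: coeff_cpk_poly_eq_0)

lemma poly_cpk_poly: "poly (cpk_poly q n) x = (\<Sum>i\<le>n div 2. coeff (cpk_poly q n) i * x ^ i)"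
  unfolding poly_altdef using degree_cpk_poly[of q n]
  by (intro sum.mono_neutral_left) (auto simp: coeff_eq_0)

lemma bpoly_eq_poly: "bpoly n x q = poly (cpk_poly q n) x"
  by (simp add: bpoly_def poly_cpk_poly coeff_cpk_poly_bcoef atMost_atLeast0
      sum_distrib_right sum_distrib_left mult_ac)

text \<open>The expansion of \<open>(1 + x)^n\<close> times the value of \<open>cpk_poly q n\<close>
  at \<open>4x / (1 + x)^2\<close>.\<close>

definition gamma_poly :: "'a::field_char_0 \<Rightarrow> nat \<Rightarrow> 'a poly" where
  "gamma_poly q n = (\<Sum>i=0..n div 2. smult (coeff (cpk_poly q n) i * 4 ^ i)
     ([:0, 1:] ^ i * [:1, 1:] ^ (n - 2 * i)))"

text \<open>With \<open>m = n - 2i\<close>, the terms with \<open>(1 + x)^(m - 1)\<close> carry the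
  factors \<open>1 + x\<close> and \<open>1 - x\<close>, whose sum is 2; hence only two basis
  elements of the next level occur.\<close>

lemma gamma_basis_step:
  fixes q :: "'a::field_char_0"
  assumes "2 * i \<le> n"
  defines "u \<equiv> \<lambda>n i. [:0, 1:] ^ i * [:1, 1:] ^ (n - 2 * i)"
  shows "[:1, 1 + 2 * q * of_nat n:] * u n i + smult (2 * q) ([:0, 1:] * [:1, -1:] * pderiv (u n i))
    = smult (1 + 2 * q * of_nat i) (u (Suc n) i) + smult (4 * q * (of_nat n - 2 * of_nat i)) (u (Suc n) (Suc i))"
proof -
  obtain m where m: "n = 2 * i + m" using assms(1) le_Suc_ex by blast
  have Xd: "[:0, 1:] * pderiv ([:0, 1:] ^ i) = smult (of_nat i) ([:0, 1:] ^ i :: 'a poly)"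
    by (cases i) (simp_all only: pderiv_power_Suc, simp_all add: pderiv_pCons)
  have Yd: "pderiv ([:1, 1:] ^ m) = smult (of_nat m) ([:1, 1:] ^ (m - 1) :: 'a poly)"
    by (cases m) (simp_all only: pderiv_power_Suc, simp_all add: pderiv_pCons)
  have ud: "[:0, 1:] * pderiv (u n i) = smult (of_nat i) (u n i)
      + smult (of_nat m) ([:0, 1:] ^ Suc i * [:1, 1:] ^ (m - 1))"
  proof -
    have "[:0, 1:] * pderiv (u n i) = ([:0, 1:] * pderiv ([:0, 1:] ^ i)) * [:1, 1:] ^ m
        + [:0, 1:] ^ Suc i * pderiv ([:1, 1:] ^ m)"
      unfolding u_def m by (simp only: pderiv_mult diff_add_inverse power_Suc) (simp add: algebra_simps)
    then show ?thesis unfolding Xd Yd u_def m by simp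
  qed
  have comm: "[:0, 1:] * [:1, -1:] * pderiv (u n i) = [:1, -1:] * ([:0, 1:] * pderiv (u n i))"
    by (simp only: mult_ac)
  show ?thesis unfolding comm ud
  proof (rule poly_eq_poly_eq_iff[THEN iffD1], rule ext)
    fix t :: 'a
    show "poly ([:1, 1 + 2 * q * of_nat n:] * u n i
        + smult (2 * q) ([:1, -1:] * (smult (of_nat i) (u n i)
        + smult (of_nat m) ([:0, 1:] ^ Suc i * [:1, 1:] ^ (m - 1))))) t
      = poly (smult (1 + 2 * q * of_nat i) (u (Suc n) i)
        + smult (4 * q * (of_nat n - 2 * of_nat i)) (u (Suc n) (Suc i))) t"
      \<comment> \<open>For \<open>m = 0\<close> the exponent \<open>m - 1\<close> is truncated, but
        its term has the factor \<open>m\<close>.\<close>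
      by (cases m) (simp_all add: u_def m algebra_simps)
  qed
qed

text \<open>A range that ignores the parity of \<open>n\<close> makes the index shift in the
  recurrence uniform.\<close>

lemma gamma_poly_sum_atMost:
  "gamma_poly q n = (\<Sum>i\<le>n. smult (coeff (cpk_poly q n) i * 4 ^ i) ([:0, 1:] ^ i * [:1, 1:] ^ (n - 2 * i)))"
  unfolding gamma_poly_def by (rule sum.mono_neutral_left) (auto simp: coeff_cpk_poly_eq_0)

lemma gamma_poly_0: "gamma_poly q 0 = 1"
  by (simp add: gamma_poly_def)

text \<open>The factors in \<open>gamma_basis_step\<close> are those of
  \<open>coeff_cpk_poly_Suc\<close>, up to a 4 that is absorbed by \<open>4 ^ Suc i\<close>.\<close>

lemma gamma_poly_Suc:
  "gamma_poly q (Suc n) = [:1, 1 + 2 * q * of_nat n:] * gamma_poly q n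
     + smult (2 * q) ([:0, 1:] * [:1, -1:] * pderiv (gamma_poly q n))"
proof -
  let ?u = "\<lambda>n i. [:0, 1:] ^ i * [:1, 1:] ^ (n - 2 * i) :: 'a poly"
  let ?c = "\<lambda>n i. coeff (cpk_poly q n) i"
  have "[:1, 1 + 2 * q * of_nat n:] * gamma_poly q n
      + smult (2 * q) ([:0, 1:] * [:1, -1:] * pderiv (gamma_poly q n))
    = (\<Sum>i\<le>n. smult (?c n i * 4 ^ i) ([:1, 1 + 2 * q * of_nat n:] * ?u n i
        + smult (2 * q) ([:0, 1:] * [:1, -1:] * pderiv (?u n i))))"
    unfolding gamma_poly_sum_atMost pderiv_sum pderiv_smult sum_distrib_left smult_sum_right
      sum.distrib[symmetric]
    by (simp only: smult_add_right smult_smult mult_smult_right mult.commute[of "2 * q"])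
  also have "\<dots> = (\<Sum>i\<le>n. smult (?c n i * 4 ^ i) (smult (1 + 2 * q * of_nat i) (?u (Suc n) i)
        + smult (4 * q * (of_nat n - 2 * of_nat i)) (?u (Suc n) (Suc i))))"
  proof (rule sum.cong[OF refl])
    fix i
    show "smult (?c n i * 4 ^ i) ([:1, 1 + 2 * q * of_nat n:] * ?u n i
        + smult (2 * q) ([:0, 1:] * [:1, -1:] * pderiv (?u n i)))
      = smult (?c n i * 4 ^ i) (smult (1 + 2 * q * of_nat i) (?u (Suc n) i)
        + smult (4 * q * (of_nat n - 2 * of_nat i)) (?u (Suc n) (Suc i)))"
    proof (cases "2 * i \<le> n")
      case True
      show ?thesis unfolding gamma_basis_step[OF True] ..
    next
      case False
      then show ?thesis by (simp add: coeff_cpk_poly_eq_0)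
    qed
  qed
  also have "\<dots> = (\<Sum>i\<le>n. smult (?c n i * 4 ^ i * (1 + 2 * q * of_nat i)) (?u (Suc n) i))
      + (\<Sum>i\<le>n. smult (4 ^ Suc i * q * (of_nat n - 2 * of_nat i) * ?c n i) (?u (Suc n) (Suc i)))"
    by (simp only: smult_add_right smult_smult sum.distrib power_Suc mult_ac)
  also have "(\<Sum>i\<le>n. smult (?c n i * 4 ^ i * (1 + 2 * q * of_nat i)) (?u (Suc n) i))
      = (\<Sum>i\<le>Suc n. smult (?c n i * 4 ^ i * (1 + 2 * q * of_nat i)) (?u (Suc n) i))"
    by (simp add: coeff_cpk_poly_eq_0)
  also have "\<dots> = ?u (Suc n) 0 
      + (\<Sum>i\<le>n. smult (?c n (Suc i) * 4 ^ Suc i * (1 + 2 * q * of_nat (Suc i))) (?u (Suc n) (Suc i)))"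
    by (subst sum.atMost_Suc_shift) (simp only: coeff_cpk_poly_0, simp)
  also have "\<dots> + (\<Sum>i\<le>n. smult (4 ^ Suc i * q * (of_nat n - 2 * of_nat i) * ?c n i) (?u (Suc n) (Suc i)))
      = ?u (Suc n) 0 + (\<Sum>i\<le>n. smult (?c (Suc n) (Suc i) * 4 ^ Suc i) (?u (Suc n) (Suc i)))"
    unfolding add.assoc sum.distrib[symmetric] smult_add_left[symmetric] coeff_cpk_poly_Suc
    by (simp only: algebra_simps)
  also have "\<dots> = gamma_poly q (Suc n)"
    unfolding gamma_poly_sum_atMost
    by (subst sum.atMost_Suc_shift) (simp only: coeff_cpk_poly_0, simp)
  finally show ?thesis ..
qed

section \<open>A partial differential equation for the generating function\<close>

text \<open>The series variable is \<open>z\<close> and the coefficients are polynomials in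
  \<open>x\<close>; this is the partial derivative in \<open>x\<close>.\<close>

definition fps_dx :: "'a::field_char_0 poly fps \<Rightarrow> 'a poly fps" where
  "fps_dx A = Abs_fps (\<lambda>n. pderiv (A $ n))"

lemma fps_dx_add: "fps_dx (A + B) = fps_dx A + fps_dx B"
  by (simp add: fps_dx_def fps_eq_iff pderiv_add)

lemma fps_dx_mult: "fps_dx (A * B) = A * fps_dx B + fps_dx A * B"
proof (rule fps_ext)
  fix n
  have "fps_dx (A * B) $ n = (\<Sum>i=0..n. A $ i * pderiv (B $ (n - i)) + pderiv (A $ i) * B $ (n - i))"
    by (simp add: fps_dx_def fps_mult_nth pderiv_sum pderiv_mult mult.commute)
  then show "fps_dx (A * B) $ n = (A * fps_dx B + fps_dx A * B) $ n"
    by (simp add: fps_dx_def fps_mult_nth sum.distrib)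
qed

lemma fps_dx_deriv: "fps_dx (fps_deriv A) = fps_deriv (fps_dx A)"
proof (rule fps_ext)
  fix n
  have "pderiv (of_nat m * p) = of_nat m * pderiv p" for m and p :: "'a poly"
    by (induction m) (simp_all add: pderiv_add algebra_simps)
  then show "fps_dx (fps_deriv A) $ n = fps_deriv (fps_dx A) $ n" 
    by (simp add: fps_dx_def del: of_nat_Suc of_nat_add)
qed

text \<open>The derivation \<open>T\<close> of the overview; eigenvalues add when eigenvectors are
  multiplied.\<close>

definition char_op :: "'a::field_char_0 \<Rightarrow> 'a poly fps \<Rightarrow> 'a poly fps" where
  "char_op q A = (1 - fps_const [:0, q:] * fps_X) * fps_deriv A
     - fps_const (smult (2 * q) ([:0, 1:] * [:1, -1:])) * fps_dx A"

lemma char_op_add: "char_op q (A + B) = char_op q A + char_op q B"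
  by (simp add: char_op_def fps_dx_add algebra_simps)

lemma char_op_mult: "char_op q (A * B) = A * char_op q B + char_op q A * B"
  unfolding char_op_def fps_dx_mult fps_deriv_mult by (simp only: algebra_simps)

lemma fps_dx_const: "fps_dx (fps_const p) = fps_const (pderiv p)"
  by (simp add: fps_dx_def fps_eq_iff)

text \<open>The two partial derivatives commute, so the extra term comes only from differentiating
  the coefficient \<open>1 - q x z\<close> in \<open>z\<close>.\<close>

lemma char_op_deriv: "char_op q (fps_deriv A) = fps_deriv (char_op q A) + fps_const [:0, q:] * fps_deriv A"
  unfolding char_op_def fps_dx_deriv by (simp add: algebra_simps)

lemma char_op_const: "char_op q (fps_const [:c:]) = 0"
  by (simp add: char_op_def fps_dx_const)

lemma char_op_nth: "char_op q A $ n = of_nat (Suc n) * A $ Suc n - of_nat n * [:0, q:] * A $ n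
   - smult (2 * q) ([:0, 1:] * [:1, -1:]) * pderiv (A $ n)"
proof -
  have *: "char_op q A = fps_deriv A - fps_const [:0, q:] * (fps_X * fps_deriv A)
     - fps_const (smult (2 * q) ([:0, 1:] * [:1, -1:])) * fps_dx A"
    by (simp only: char_op_def algebra_simps mult_1_left)
  show ?thesis unfolding *
    by (cases n) (simp_all add: fps_dx_def algebra_simps)
qed

text \<open>The equation expresses \<open>(n + 1) V $ Suc n\<close> through \<open>V $ n\<close> and
  its derivative, so a zero constant term propagates to all coefficients.\<close>

lemma char_op_eigen_zero:
  fixes V :: "'a::field_char_0 poly fps"
  assumes "char_op q V = fps_const c * V" "V $ 0 = 0"
  shows "V = 0"
proof (rule fps_ext)
  fix n
  show "V $ n = 0 $ n"
  proof (induction n)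
    case (Suc n)
    have "char_op q V $ n = 0" using assms Suc by simp
    with Suc have "of_nat (Suc n) * V $ Suc n = 0"
      unfolding char_op_nth by simp
    then show ?case by (simp del: of_nat_Suc)
  qed (simp add: assms)
qed

section \<open>The cycle peak series and the hyperbolic denominator\<close>

definition cpk_egf :: "'a::field_char_0 \<Rightarrow> 'a poly fps" where
  "cpk_egf q = Abs_fps (\<lambda>n. smult (inverse (fact n)) (cpk_poly q n))"

lemma fact_Suc_cancel: "of_nat (Suc n) * smult (inverse (fact (Suc n))) p = smult (inverse (fact n)) (p :: 'a::field_char_0 poly)"
  by (simp add: of_nat_poly field_simps del: of_nat_Suc)

text \<open>Coefficient by coefficient this is the recurrence of \<open>cpk_poly\<close> divided by
  \<open>n!\<close>.\<close>

lemma char_op_cpk_egf: "char_op q (cpk_egf q) = cpk_egf q"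
proof (rule fps_ext)
  fix n
  show "char_op q (cpk_egf q) $ n = cpk_egf q $ n"
    unfolding char_op_nth cpk_egf_def fps_nth_Abs_fps fact_Suc_cancel pderiv_smult
    by (simp add: algebra_simps of_nat_poly smult_add_right)
qed

text \<open>The series cosh(qsz) - sinh(qsz) / s involves only even powers of s, so it is a power series
  over the polynomials in x = 1 - s^2.\<close>
definition hyp_poly :: "nat \<Rightarrow> 'a::field_char_0 poly" where
  "hyp_poly n = (if even n then 1 else -1) * [:1, -1:] ^ (n div 2)"

definition hyp_egf :: "'a::field_char_0 \<Rightarrow> 'a poly fps" where
  "hyp_egf q = Abs_fps (\<lambda>n. smult (inverse (fact n)) (smult (q ^ n) (hyp_poly n)))"

text \<open>Applying \<open>2x(1 - x) d/dx\<close> to \<open>(1 - x)^m\<close> multiplies it by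
  \<open>-2mx\<close>. With \<open>m = n div 2\<close> the total factor is \<open>-1\<close> for
  even \<open>n\<close> and \<open>x - 1\<close> for odd \<open>n\<close>.\<close>

lemma hyp_poly_Suc: "hyp_poly (Suc n) = of_nat n * [:0, 1:] * hyp_poly n
   + smult 2 ([:0, 1:] * [:1, -1:]) * pderiv (hyp_poly n) - (hyp_poly n :: 'a::field_char_0 poly)"
proof -
  have Yd: "[:1, -1:] * pderiv ([:1, -1:] ^ m) = smult (- of_nat m) ([:1, -1:] ^ m :: 'a poly)" for m
    by (cases m) (simp_all only: pderiv_power_Suc, simp_all add: pderiv_pCons)
  have Yd2: "smult 2 ([:0, 1:] * [:1, -1:]) * pderiv ([:1, -1:] ^ m) 
      = [:0, - 2 * of_nat m:] * ([:1, -1:] ^ m :: 'a poly)" for m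
  proof -
    have "smult 2 ([:0, 1:] * [:1, -1:]) * pderiv ([:1, -1:] ^ m) 
       = [:0, 2:] * ([:1, -1:] * pderiv ([:1, -1:] ^ m :: 'a poly))" by (simp add: mult_ac smult_add_right)
    also have "\<dots> = [:0, - 2 * of_nat m:] * ([:1, -1:] ^ m :: 'a poly)" unfolding Yd by (simp add: mult.commute)
    finally show ?thesis .
  qed
  have "smult 2 ([:0, 1:] * [:1, -1:]) * pderiv (hyp_poly n)
      = [:0, - 2 * of_nat (n div 2):] * (hyp_poly n :: 'a poly)"
  proof (cases "even n")
    case True
    then show ?thesis using Yd2[of "n div 2"] by (simp add: hyp_poly_def)
  next
    case False
    then have h: "hyp_poly n = - ([:1, -1:] ^ (n div 2) :: 'a poly)" by (simp add: hyp_poly_def)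
    show ?thesis unfolding h pderiv_minus mult_minus_right Yd2 ..
  qed
  note * = this
  show ?thesis unfolding *
  proof (cases "even n")
    case True
    then obtain m where m: "n = 2 * m" by blast
    show "hyp_poly (Suc n) = of_nat n * [:0, 1:] * hyp_poly n
        + [:0, - 2 * of_nat (n div 2):] * hyp_poly n - (hyp_poly n :: 'a poly)"
      unfolding m hyp_poly_def by (simp add: of_nat_poly)
  next
    case False
    then obtain m where m: "n = 2 * m + 1" using oddE by blast
    show "hyp_poly (Suc n) = of_nat n * [:0, 1:] * hyp_poly n
        + [:0, - 2 * of_nat (n div 2):] * hyp_poly n - (hyp_poly n :: 'a poly)"
      unfolding m hyp_poly_def by (simp add: of_nat_poly smult_add_left)
  qed
qed

lemma char_op_hyp_egf: "char_op q (hyp_egf q) = fps_const [:- q:] * hyp_egf q"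
proof (rule fps_ext)
  fix n
  show "char_op q (hyp_egf q) $ n = (fps_const [:- q:] * hyp_egf q) $ n"
    unfolding char_op_nth hyp_egf_def fps_nth_Abs_fps fact_Suc_cancel pderiv_smult hyp_poly_Suc fps_mult_left_const_nth
    by (simp add: algebra_simps of_nat_poly smult_add_right smult_diff_right)
qed

text \<open>In other words, the logarithmic derivative of \<open>cpk_egf q\<close> is
  \<open>-1/q\<close> times that of \<open>hyp_egf q\<close>, written without division because the
  coefficients are polynomials.\<close>

lemma cpk_egf_hyp_egf:
  assumes "q \<noteq> 0"
  shows "fps_deriv (cpk_egf q) * hyp_egf q = fps_const [:- 1 / q:] * fps_deriv (hyp_egf q) * cpk_egf q"
proof -
  let ?F = "cpk_egf q" and ?D = "hyp_egf q"
  let ?c = "fps_const [:1 / q:]"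
  define V where "V = fps_deriv ?F * ?D + ?c * (fps_deriv ?D * ?F)"
  have F': "char_op q (fps_deriv ?F) = (1 + fps_const [:0, q:]) * fps_deriv ?F"
    by (simp add: char_op_deriv char_op_cpk_egf algebra_simps)
  have D': "char_op q (fps_deriv ?D) = (fps_const [:- q:] + fps_const [:0, q:]) * fps_deriv ?D"
    by (simp only: char_op_deriv char_op_hyp_egf fps_deriv_mult_const_left distrib_right)
  \<comment> \<open>Both summands have the same eigenvalue: \<open>(1 + qx) + (-q)\<close> for the
    first and \<open>(-q + qx) + 1\<close> for the second.\<close>
  have "char_op q V = (1 + fps_const [:0, q:] + fps_const [:- q:]) * V"
    unfolding V_def char_op_add char_op_mult F' D' char_op_const char_op_cpk_egf char_op_hyp_egf
    by (simp only: algebra_simps mult_1_left mult_zero_left add_0_left)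
  also have "1 + fps_const [:0, q:] + fps_const [:- q:] = fps_const (1 + [:0, q:] + [:- q:])"
    by (simp only: fps_const_add[symmetric] fps_const_1_eq_1)
  finally have "V = 0"
  proof (rule char_op_eigen_zero)
    \<comment> \<open>The linear coefficients of the two series are \<open>1\<close> and
      \<open>-q\<close>, so the constant term is \<open>1 + (1/q)(-q)\<close>.\<close>
    show "V $ 0 = 0" using assms
      by (simp add: V_def cpk_egf_def hyp_egf_def hyp_poly_def fps_mult_nth_0 one_pCons)
  qed
  moreover have c: "fps_const [:- 1 / q:] = - ?c" by simp
  ultimately show ?thesis unfolding V_def c
    by (simp only: mult_minus_left eq_neg_iff_add_eq_0 mult.assoc)
qed

section \<open>Generating function as a power\<close>

lemma fps_powc_nth_0: "fps_powc G a $ 0 = 1"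
  by (simp add: fps_powc_def fps_compose_nth_0)

text \<open>The binomial series \<open>b\<close> satisfies \<open>(1 + z) b' = a b\<close>;
  substituting \<open>G - 1\<close> and using the chain rule gives the claim.\<close>

lemma fps_powc_ODE:
  fixes G :: "'a::field_char_0 fps"
  assumes "G $ 0 = 1"
  shows "G * fps_deriv (fps_powc G a) = fps_const a * fps_deriv G * fps_powc G a"
proof -
  let ?b = "fps_binomial a"
  have G0: "(G - 1) $ 0 = 0" using assms by simp
  have "(1 + fps_X) * fps_deriv ?b = fps_const a * ?b"
    unfolding fps_binomial_deriv by (simp add: fps_divide_unit mult.left_commute inverse_mult_eq_1')
  then have "((1 + fps_X) * fps_deriv ?b) oo (G - 1) = (fps_const a * ?b) oo (G - 1)" by simp
  then have *: "G * (fps_deriv ?b oo (G - 1)) = fps_const a * fps_powc G a"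
    using G0 by (simp add: fps_compose_mult_distrib fps_compose_add_distrib fps_powc_def)
  have "G * fps_deriv (fps_powc G a) = (G * (fps_deriv ?b oo (G - 1))) * fps_deriv G"
    using fps_compose_deriv[OF G0, of ?b] by (simp add: fps_powc_def mult.assoc)
  then show ?thesis unfolding * by (simp add: mult_ac)
qed

text \<open>Uniqueness for a linear differential equation: the power solves the same equation as
  \<open>F\<close>, so their quotient is constant, and both constant terms are 1.\<close>

lemma fps_powc_inverse_eqI:
  fixes F D :: "'a::field_char_0 fps"
  assumes F0: "F $ 0 = 1" and D0: "D $ 0 = 1"
    and ode: "fps_deriv F * D = fps_const (- a) * fps_deriv D * F"
  shows "F = fps_powc (inverse D) a"
proof -
  let ?P = "fps_powc (inverse D) a"
  let ?Q = "inverse ?P"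
  have DI: "D * inverse D = 1" using D0 by (simp add: inverse_mult_eq_1')
  have PQ: "?P * ?Q = 1" by (simp add: inverse_mult_eq_1' fps_powc_nth_0)
  have "inverse D * fps_deriv ?P = fps_const a * fps_deriv (inverse D) * ?P"
    using D0 by (intro fps_powc_ODE) simp
  also have "fps_deriv (inverse D) = - fps_deriv D * (inverse D)\<^sup>2"
    using D0 by (subst fps_inverse_deriv) simp_all
  \<comment> \<open>The factor \<open>D\<^sup>2\<close> clears the inverses of
    \<open>D\<close>.\<close>
  finally have "D\<^sup>2 * (inverse D * fps_deriv ?P) 
      = D\<^sup>2 * (fps_const a * (- fps_deriv D * (inverse D)\<^sup>2) * ?P)" by simp
  moreover have "D\<^sup>2 * (inverse D * fps_deriv ?P) = (D * inverse D) * (D * fps_deriv ?P)"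
    by (simp add: power2_eq_square mult_ac)
  moreover have "D\<^sup>2 * (fps_const a * (- fps_deriv D * (inverse D)\<^sup>2) * ?P)
     = (D * inverse D)\<^sup>2 * (- (fps_const a * fps_deriv D * ?P))"
    by (simp add: power2_eq_square mult_ac)
  ultimately have P: "D * fps_deriv ?P = - (fps_const a * fps_deriv D * ?P)"
    unfolding DI by simp
  \<comment> \<open>The nonzero factor \<open>D * ?P\<close> is later cancelled, which leaves a
    vanishing derivative.\<close>
  have "D * ?P * fps_deriv (F * ?Q) = 0"
  proof -
    have *: "fps_deriv (F * ?Q) = fps_deriv F * ?Q - F * fps_deriv ?P * ?Q\<^sup>2"
      by (simp add: fps_inverse_deriv fps_powc_nth_0)
    have "D * ?P * fps_deriv (F * ?Q)
       = (fps_deriv F * D) * (?P * ?Q) - F * (D * fps_deriv ?P) * (?P * ?Q) * ?Q"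
      unfolding * by (simp add: power2_eq_square algebra_simps)
    also have "\<dots> = fps_const (- a) * fps_deriv D * F - F * (D * fps_deriv ?P) * ?Q"
      unfolding PQ ode by simp
    also have "\<dots> = fps_const (- a) * fps_deriv D * F + F * (fps_const a * fps_deriv D) * (?P * ?Q)"
      unfolding P by (simp add: algebra_simps)
    also have "\<dots> = (fps_const (- a) + fps_const a) * fps_deriv D * F"
      unfolding PQ by (simp only: algebra_simps mult_1_left mult_1_right)
    also have "\<dots> = 0" by simp
    finally show ?thesis .
  qed
  moreover have "D \<noteq> 0" "?P \<noteq> 0" using D0 PQ by auto
  ultimately have "fps_deriv (F * ?Q) = 0" by simp
  then have "F * ?Q = fps_const ((F * ?Q) $ 0)" by (rule fps_deriv_eq_0_iff[THEN iffD1])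
  then have FQ: "F * ?Q = 1" using F0 by (simp add: fps_powc_nth_0)
  have "F = F * (?P * ?Q)" unfolding PQ by simp
  also have "\<dots> = F * ?Q * ?P" by (simp only: mult_ac)
  finally show ?thesis unfolding FQ by simp
qed

text \<open>Specialising \<open>x\<close> leads from polynomial coefficients to a field, where
  \<open>fps_powc\<close> with exponent \<open>1 / q\<close> makes sense.\<close>

definition fps_eval :: "'a::field_char_0 \<Rightarrow> 'a poly fps \<Rightarrow> 'a fps" where
  "fps_eval x A = Abs_fps (\<lambda>n. poly (A $ n) x)"

lemma fps_eval_mult: "fps_eval x (A * B) = fps_eval x A * fps_eval x B"
  by (simp add: fps_eval_def fps_eq_iff fps_mult_nth poly_sum)

lemma fps_eval_deriv: "fps_eval x (fps_deriv A) = fps_deriv (fps_eval x A)"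
  by (simp add: fps_eval_def fps_eq_iff of_nat_poly del: of_nat_Suc)

lemma fps_eval_const: "fps_eval x (fps_const p) = fps_const (poly p x)"
  by (simp add: fps_eval_def fps_eq_iff)

text \<open>At \<open>x = 1 - s^2\<close> the powers of \<open>1 - x\<close> become even powers of
  \<open>s\<close>; the factor \<open>s\<close> turns \<open>sinh / s\<close> into
  \<open>sinh\<close>. Even coefficients belong to cosh, odd ones to sinh.\<close>

lemma fps_eval_hyp_egf:
  fixes s q :: "'a::field_char_0"
  assumes "s \<noteq> 0"
  shows "fps_const s * fps_eval (1 - s\<^sup>2) (hyp_egf q) =
     fps_const s * (fps_const (1/2) * (fps_exp (q * s) + fps_exp (- (q * s))))
     - fps_const (1/2) * (fps_exp (q * s) - fps_exp (- (q * s)))"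
proof (rule fps_ext)
  fix n
  show "(fps_const s * fps_eval (1 - s\<^sup>2) (hyp_egf q)) $ n =
     (fps_const s * (fps_const (1/2) * (fps_exp (q * s) + fps_exp (- (q * s))))
     - fps_const (1/2) * (fps_exp (q * s) - fps_exp (- (q * s)))) $ n"
  proof (cases "even n")
    case True
    then have "(s\<^sup>2) ^ (n div 2) = s ^ n" by (simp add: power_mult[symmetric])
    with True show ?thesis
      by (simp add: fps_eval_def hyp_egf_def hyp_poly_def power_mult_distrib field_simps)
  next
    case False
    then have "s * (s\<^sup>2) ^ (n div 2) = s ^ n"
      by (simp add: power_mult[symmetric] power_Suc[symmetric] del: power_Suc)
    with False show ?thesis
      by (simp add: fps_eval_def hyp_egf_def hyp_poly_def power_mult_distrib field_simps)
  qed
qed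

text \<open>The parameter \<open>s\<close> replaces a square root of \<open>1 - x\<close>, so any
  field of characteristic 0 is allowed. The scaling \<open>y\<close> of \<open>z\<close> is 1 for
  the cycle peak series and \<open>1 + X\<close> for the series of \<open>Bk\<close>.\<close>

theorem bpoly_egf:
  fixes s q y :: "'a::field_char_0"
  assumes s: "s \<noteq> 0" and q: "q \<noteq> 0"
  defines "c \<equiv> y * (q * s)"
  shows "Abs_fps (\<lambda>n. y ^ n * bpoly n (1 - s\<^sup>2) q / fact n) =
     fps_powc (fps_const s / (fps_const s * (fps_const (1/2) * (fps_exp c + fps_exp (- c)))
       - fps_const (1/2) * (fps_exp c - fps_exp (- c)))) (1 / q)"
proof -
  let ?x = "1 - s\<^sup>2"
  let ?F = "fps_eval ?x (cpk_egf q)" and ?D = "fps_eval ?x (hyp_egf q)"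
  let ?Y = "fps_const y * fps_X"
  have Y0: "?Y $ 0 = 0" by simp
  define F where "F = ?F oo ?Y"
  define D where "D = ?D oo ?Y"
  have "fps_eval ?x (fps_deriv (cpk_egf q) * hyp_egf q)
      = fps_eval ?x (fps_const [:- 1 / q:] * fps_deriv (hyp_egf q) * cpk_egf q)"
    by (simp only: cpk_egf_hyp_egf[OF q])
  then have ode: "fps_deriv ?F * ?D = fps_const (- 1 / q) * fps_deriv ?D * ?F"
    by (simp add: fps_eval_mult fps_eval_deriv fps_eval_const)
  \<comment> \<open>The chain rule multiplies both sides by the same factor, so the scaled series
    obey an equation of the same form.\<close>
  have "(fps_deriv ?F oo ?Y) * D = fps_const (- 1 / q) * (fps_deriv ?D oo ?Y) * F"
    using arg_cong[OF ode, of "\<lambda>A. A oo ?Y"] 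
    by (simp add: fps_compose_mult_distrib[OF Y0] F_def D_def)
  then have "fps_deriv F * D = fps_const (- (1 / q)) * fps_deriv D * F"
    unfolding F_def D_def fps_compose_deriv[OF Y0] by (simp add: mult_ac)
  moreover have "F $ 0 = 1" by (simp add: F_def fps_compose_nth_0 fps_eval_def cpk_egf_def)
  moreover have D0: "D $ 0 = 1" by (simp add: D_def fps_compose_nth_0 fps_eval_def hyp_egf_def hyp_poly_def)
  ultimately have "F = fps_powc (inverse D) (1 / q)" by (intro fps_powc_inverse_eqI)
  moreover have "F = Abs_fps (\<lambda>n. y ^ n * bpoly n (1 - s\<^sup>2) q / fact n)"
    unfolding F_def fps_compose_linear
    by (simp add: fps_eval_def cpk_egf_def bpoly_eq_poly fps_eq_iff divide_inverse mult_ac)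
  moreover have "fps_const s * D = fps_const s * (fps_const (1/2) * (fps_exp c + fps_exp (- c)))
       - fps_const (1/2) * (fps_exp c - fps_exp (- c))"
  proof -
    have "fps_const s * D = (fps_const s * ?D) oo ?Y" 
      by (simp add: D_def fps_compose_mult_distrib[OF Y0])
    also have "\<dots> = fps_const s * (fps_const (1/2) * (fps_exp c + fps_exp (- c)))
       - fps_const (1/2) * (fps_exp c - fps_exp (- c))"
      unfolding fps_eval_hyp_egf[OF s] 
      by (simp add: fps_compose_mult_distrib[OF Y0] fps_compose_add_distrib fps_compose_sub_distrib c_def)
    finally show ?thesis .
  qed
  moreover have "fps_const s / (fps_const s * D) = inverse D"
    using s D0 by (simp add: fps_divide_unit fps_inverse_mult fps_const_inverse mult.assoc[symmetric])
  ultimately show ?thesis by metis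
qed

lemma b_egf_rhs_eq:
  assumes "x \<noteq> 1" "q \<noteq> 0"
  shows "Abs_fps (\<lambda>n. bpoly n x q / fact n) = b_egf_rhs x q"
proof -
  have "csqrt (1 - x) \<noteq> 0" using assms by simp
  from bpoly_egf[OF this assms(2), of 1] show ?thesis
    by (simp add: b_egf_rhs_def Let_def)
qed

section \<open>Passing to the field of rational functions\<close>

lemma to_fract_power: "to_fract (p ^ n) = to_fract p ^ n"
  by (induction n) simp_all

lemma to_fract_smult: "to_fract (smult c p) = to_fract [:c:] * to_fract p"
proof -
  have "smult c p = [:c:] * p" by simp
  then show ?thesis by (simp only: to_fract_mult)
qed

lemma to_fract_of_nat: "to_fract (of_nat n) = of_nat n"
  by (induction n) simp_all

text \<open>The recurrence for the coefficients is integral in \<open>q\<close>, so it commutes with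
  the embedding of constants into the rational functions.\<close>

lemma coeff_cpk_poly_to_fract:
  fixes k :: "'a::linordered_field"
  shows "coeff (cpk_poly (to_fract [:k:]) n) i = to_fract [:coeff (cpk_poly k n) i:]"
proof (induction n arbitrary: i)
  case 0
  then show ?case by (cases i) (simp_all add: one_pCons[symmetric])
next
  case (Suc n)
  show ?case
  proof (cases i)
    case 0
    then show ?thesis by (simp only: coeff_cpk_poly_0 one_pCons[symmetric] to_fract_1)
  next
    case (Suc m)
    have nat: "to_fract [:of_nat l :: 'a:] = of_nat l" for l :: nat
      using to_fract_of_nat[of l, where 'a="'a poly"] by (simp only: of_nat_poly)
    have two: "(2 :: 'a poly fract) = to_fract [:2:]"
      using nat[of 2] by simp
    show ?thesis unfolding Suc coeff_cpk_poly_Suc Suc.IH nat[symmetric] two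
      unfolding to_fract_mult[symmetric] to_fract_diff[symmetric] to_fract_add[symmetric] to_fract_1[symmetric]
      by (simp add: one_pCons mult_ac)
  qed
qed

text \<open>Numerator and denominator are multiplied by \<open>(1 + X) * fps_exp c\<close>; since
  \<open>(1 + X) * s = 1 - X\<close>, the denominator becomes
  \<open>1 - X * fps_exp (2 * c)\<close>.\<close>

lemma hyperbolic_quotient_eq_exp_quotient:
  fixes X c :: "'a::field_char_0"
  assumes X: "X \<noteq> 1" "X \<noteq> -1"
  defines "s \<equiv> (1 - X) / (1 + X)"
  shows "fps_const s / (fps_const s * (fps_const (1/2) * (fps_exp c + fps_exp (- c)))
       - fps_const (1/2) * (fps_exp c - fps_exp (- c)))
    = fps_const (1 - X) * fps_exp c / (1 - fps_const X * fps_exp (2 * c))" (is "_ / ?N = _ * ?E / ?M")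
proof -
  have X': "1 + X \<noteq> 0" using X(2) by (metis add_eq_0_iff)
  have s: "s \<noteq> 0" using X X' by (simp add: s_def)
  have ys: "(1 + X) * s = 1 - X" using X' by (simp add: s_def)
  have N0: "?N $ 0 \<noteq> 0" and M0: "?M $ 0 \<noteq> 0" using s X by simp_all
  have E: "?E * fps_exp (- c) = 1" by (simp add: fps_exp_add_mult[symmetric])
  have E2: "?E * ?E = fps_exp (2 * c)" by (simp add: fps_exp_add_mult[symmetric])
  have "?N * ?E = fps_const s * fps_const (1/2) * (?E * ?E + ?E * fps_exp (- c)) 
      - fps_const (1/2) * (?E * ?E - ?E * fps_exp (- c))"
    by (simp only: algebra_simps)
  also have "\<dots> = fps_const ((s - 1) / 2) * fps_exp (2 * c) + fps_const ((s + 1) / 2)"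
    unfolding E E2 by (simp add: fps_eq_iff field_simps)
  finally have "fps_const (1 + X) * (?N * ?E) 
      = fps_const ((1 + X) * ((s - 1) / 2)) * fps_exp (2 * c) + fps_const ((1 + X) * ((s + 1) / 2))"
    by (simp add: distrib_left mult.assoc[symmetric])
  also have "(1 + X) * ((s - 1) / 2) = ((1 + X) * s - (1 + X)) / 2"
    by (simp add: right_diff_distrib)
  also have "\<dots> = - X" unfolding ys by simp
  also have "(1 + X) * ((s + 1) / 2) = ((1 + X) * s + (1 + X)) / 2"
    by (simp add: distrib_left)
  also have "\<dots> = 1" unfolding ys by simp
  also have "fps_const (- X) * fps_exp (2 * c) + fps_const 1 = ?M"
    by (simp add: fps_const_neg[symmetric] del: fps_const_neg)
  finally have NM: "fps_const (1 + X) * (?N * ?E) = ?M" .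
  have "fps_const s / ?N = fps_const s * inverse ?N * (?M * inverse ?M)"
    using N0 M0 by (simp add: fps_divide_unit inverse_mult_eq_1')
  also have "\<dots> = fps_const s * (fps_const (1 + X) * ((inverse ?N * ?N) * ?E)) * inverse ?M"
    unfolding NM[symmetric] by (simp only: mult_ac)
  also have "inverse ?N * ?N = 1" by (rule inverse_mult_eq_1[OF N0])
  also have "fps_const s * (fps_const (1 + X) * (1 * ?E)) = fps_const (1 - X) * ?E"
    using X' by (simp add: mult.assoc[symmetric] s_def)
  also have "\<dots> * inverse ?M = \<dots> / ?M" using M0 by (simp add: fps_divide_unit)
  finally show ?thesis .
qed

text \<open>This is \<open>bpoly_egf\<close> over the rational functions with
  \<open>y = 1 + X\<close> and \<open>s = (1 - X) / (1 + X)\<close>, so that \<open>1 - x\<close> is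
  a square there.\<close>

lemma Bk_eq_gamma_poly:
  assumes "k > 0"
  shows "Bk k n = to_fract (gamma_poly k n)"
proof -
  define X where "X = to_fract [:0, 1::real:]"
  define \<kappa> where "\<kappa> = to_fract [:k:]"
  define s where "s = (1 - X) / (1 + X)"
  have y: "1 + X = to_fract [:1, 1:]"
    by (simp only: X_def to_fract_1[symmetric] to_fract_add[symmetric]) (simp add: one_pCons)
  have y0: "1 + X \<noteq> 0" unfolding y by simp
  then have X2: "X \<noteq> -1" by auto
  have X1: "X \<noteq> 1" 
  proof
    assume "X = 1"
    then have "to_fract [:0, 1::real:] = to_fract 1" by (simp only: X_def to_fract_1)
    then show False unfolding to_fract_eq_iff by (simp add: one_pCons)
  qed
  have s0: "s \<noteq> 0" using X1 y0 by (simp add: s_def)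
  have \<kappa>0: "\<kappa> \<noteq> 0" using assms by (simp add: \<kappa>_def)
  \<comment> \<open>This matches the exponent \<open>k (1 - x)\<close> in
    \<open>B_egf\<close>.\<close>
  have c: "(1 + X) * (\<kappa> * s) = \<kappa> * (1 - X)" using y0 by (simp add: s_def)
  have "B_egf k = Abs_fps (\<lambda>n. (1 + X) ^ n * bpoly n (1 - s\<^sup>2) \<kappa> / fact n)"
    unfolding bpoly_egf[OF s0 \<kappa>0] c
    unfolding s_def hyperbolic_quotient_eq_exp_quotient[OF X1 X2]
    by (simp add: B_egf_def Let_def X_def \<kappa>_def)
  then have "Bk k n = (1 + X) ^ n * bpoly n (1 - s\<^sup>2) \<kappa>"
    by (simp add: Bk_def)
  \<comment> \<open>This substitution is the source of the factors \<open>4 ^ i\<close>.\<close>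
  also have "1 - s\<^sup>2 = 4 * X / (1 + X)\<^sup>2"
    using y0 by (simp add: s_def power_divide field_simps) (simp add: power2_eq_square algebra_simps)
  also have "(1 + X) ^ n * bpoly n (4 * X / (1 + X)\<^sup>2) \<kappa>
      = (\<Sum>i=0..n div 2. to_fract [:coeff (cpk_poly k n) i:] * 4 ^ i * (X ^ i * (1 + X) ^ (n - 2 * i)))"
    unfolding bpoly_eq_poly poly_cpk_poly sum_distrib_left atMost_atLeast0 \<kappa>_def coeff_cpk_poly_to_fract
  proof (rule sum.cong[OF refl])
    fix i assume "i \<in> {0..n div 2}"
    \<comment> \<open>Since \<open>2 * i \<le> n\<close>, the power \<open>(1 + X) ^ n\<close>
      absorbs the denominator of the \<open>i\<close>-th term.\<close>
    then have "(1 + X) ^ n = (1 + X) ^ (n - 2 * i) * ((1 + X)\<^sup>2) ^ i"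
      by (simp add: power_mult[symmetric] power_add[symmetric])
    then show "(1 + X) ^ n * (to_fract [:coeff (cpk_poly k n) i:] * (4 * X / (1 + X)\<^sup>2) ^ i)
      = to_fract [:coeff (cpk_poly k n) i:] * 4 ^ i * (X ^ i * (1 + X) ^ (n - 2 * i))"
      using y0 by (simp add: power_divide power_mult_distrib)
  qed
  also have "\<dots> = to_fract (gamma_poly k n)"
  proof -
    have "to_fract [:4::real:] = 4" using to_fract_of_nat[of 4, where 'a="real poly"]
      by (simp add: numeral_poly)
    note four = this
    have 4: "to_fract [:a * 4 ^ i:] = to_fract [:a:] * 4 ^ i" for a :: real and i
    proof -
      have "[:a * 4 ^ i:] = [:a:] * [:4:] ^ i" by (simp add: poly_const_pow)
      then show ?thesis by (simp only: to_fract_mult to_fract_power four)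
    qed
    show ?thesis
      unfolding gamma_poly_def to_fract_sum to_fract_smult 4 to_fract_mult to_fract_power y
      by (simp add: X_def)
  qed
  finally show ?thesis .
qed

section \<open>Insertion into permutations\<close>

text \<open>The composition inserts \<open>M\<close> into the cycle of \<open>b\<close>, immediately
  before \<open>b\<close>: the preimage of \<open>b\<close> now goes to \<open>M\<close>, and
  \<open>M\<close> goes to \<open>b\<close>.\<close>

lemma orbit_transpose_comp:
  assumes "f permutes S" "M \<notin> S" "x \<in> S"
  shows "orbit (Transposition.transpose M b \<circ> f) x = (if b \<in> orbit f x then insert M (orbit f x) else orbit f x)"
    (is "orbit ?g x = ?R")
proof -
  have fM: "f M = M" using assms(1,2) by (simp add: permutes_not_in)
  have f_in: "f y \<in> S \<longleftrightarrow> y \<in> S" for y using assms(1) by (rule permutes_in_image)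
  have g: "?g y = (if f y = b then M else f y)" if "y \<in> S" for y
    using that f_in[of y] assms(2) by (auto simp: Transposition.transpose_def)
  have gM: "?g M = b" by (simp add: fM)
  have orb: "orbit f x \<subseteq> S" using assms(1,3) by (rule permutes_orbit_subset)
  \<comment> \<open>One step of \<open>f\<close> is one step of \<open>?g\<close>, or two steps
    passing through \<open>M\<close>. As \<open>orbit f x\<close> starts at \<open>f x\<close>, this
    also covers the base case below.\<close>
  have adv: "f y \<in> orbit ?g x" if "y \<in> S" "?g y \<in> orbit ?g x" for y
    using that(2) gM orbit.step[of M ?g x] unfolding g[OF that(1)] by (auto split: if_splits)
  have sub: "y \<in> orbit ?g x" if "y \<in> orbit f x" for y
    using that
  proof induction
    case base
    show ?case by (rule adv[OF assms(3)]) (rule orbit.base)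
  next
    case (step y)
    then have "y \<in> S" using orb by auto
    then show ?case by (rule adv) (rule orbit.step[OF step.IH])
  qed
  have M_in: "M \<in> orbit ?g x" if "b \<in> orbit f x"
    using that
  proof cases
    case base
    then show ?thesis using g[OF assms(3)] orbit.base[of ?g x] by simp
  next
    case (step y)
    then show ?thesis using g[of y] orb orbit.step[OF sub[of y]] by auto
  qed
  show ?thesis
  proof (rule equalityI; rule subsetI)
    fix z assume "z \<in> orbit ?g x"
    then show "z \<in> ?R"
    proof induction
      case base
      then show ?case using g[OF assms(3)] orbit.base[of f x] by auto
    next
      case (step z)
      show ?case
      proof (cases "z = M")
        case True
        then have "b \<in> orbit f x" using step.IH orb assms(2) by (auto split: if_splits)
        then show ?thesis unfolding True gM by simp
      next
        case False
        then have z: "z \<in> orbit f x" using step.IH by (auto split: if_splits)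
        then have "z \<in> S" using orb by auto
        then show ?thesis using g[of z] orbit.step[OF z] by auto
      qed
    qed
  qed (use sub M_in in \<open>auto split: if_splits\<close>)
qed

text \<open>Adding \<open>M\<close> to the orbit that contains \<open>b\<close> maps old orbits onto
  new ones; it is injective because \<open>M\<close> lies in no old orbit.\<close>

lemma num_cycles_transpose_comp:
  assumes "f permutes S" "finite S" "M \<notin> S" "b \<in> S"
  shows "num_cycles (Transposition.transpose M b \<circ> f) (insert M S) = num_cycles f S"
proof -
  let ?g = "Transposition.transpose M b \<circ> f"
  define h where "h = (\<lambda>C. if b \<in> C then insert M C else C)"
  have fM: "f M = M" using assms(1,3) by (simp add: permutes_not_in)
  have "f permutes insert M S" using assms(1) by (rule permutes_imp_permutes_insert)
  then have "?g permutes insert M S"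
    by (rule permutes_compose) (use assms(4) in \<open>auto intro: permutes_swap_id\<close>)
  then have "permutation ?g" using assms(2) by (auto simp: permutation_permutes)
  from permutation_orbit_step[OF this, of M] have "orbit ?g M = orbit ?g b" by (simp add: fM)
  then have "(\<lambda>x. orbit ?g x) ` insert M S = (\<lambda>x. orbit ?g x) ` S" using assms(4) by auto
  also have "\<dots> = (\<lambda>x. h (orbit f x)) ` S"
    by (intro image_cong refl) (simp only: orbit_transpose_comp[OF assms(1,3)] h_def)
  also have "\<dots> = h ` (\<lambda>x. orbit f x) ` S" by (simp only: image_image)
  finally have "num_cycles ?g (insert M S) = card (h ` (\<lambda>x. orbit f x) ` S)"
    by (simp only: num_cycles_def)
  also have "\<dots> = num_cycles f S"
    unfolding num_cycles_def
  proof (rule card_image, rule inj_onI)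
    fix P Q assume P: "P \<in> (\<lambda>x. orbit f x) ` S" and Q: "Q \<in> (\<lambda>x. orbit f x) ` S" and eq: "h P = h Q"
    have "M \<notin> P" "M \<notin> Q" using P Q permutes_orbit_subset[OF assms(1)] assms(3) by auto
    then show "P = Q" using eq unfolding h_def by (auto split: if_splits)
  qed
  finally show ?thesis .
qed

lemma num_cycles_insert_fixpoint:
  assumes "f permutes S" "finite S" "M \<notin> S"
  shows "num_cycles f (insert M S) = Suc (num_cycles f S)"
proof -
  have "orbit f M = {M}" using assms(1,3) by (simp add: orbit_eq_singleton_iff permutes_not_in)
  moreover have "{M} \<notin> (\<lambda>x. orbit f x) ` S"
    using permutes_orbit_subset[OF assms(1)] assms(3) by auto
  ultimately show ?thesis using assms(2) by (simp add: num_cycles_def)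
qed

section \<open>Cycle counts and sums under insertion\<close>

lemma num_cycles_le_card: "finite S \<Longrightarrow> num_cycles f S \<le> card S"
  unfolding num_cycles_def by (rule card_image_le)

lemma cycS_le: "cycS n p \<le> n"
  unfolding cycS_def using num_cycles_le_card[of "{1..n}" p] by simp

lemma cycS_transpose_comp:
  assumes "p permutes {1..n}" "b \<in> {1..n}"
  shows "cycS (Suc n) (Transposition.transpose (Suc n) b \<circ> p) = cycS n p"
  using num_cycles_transpose_comp[OF assms(1) _ _ assms(2), of "Suc n"]
  by (simp add: cycS_def atLeastAtMostSuc_conv)

lemma cycS_Suc:
  assumes "p permutes {1..n}"
  shows "cycS (Suc n) p = Suc (cycS n p)"
  using num_cycles_insert_fixpoint[OF assms, of "Suc n"]
  by (simp add: cycS_def atLeastAtMostSuc_conv)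

text \<open>The new element is either a fixed point, which is the trivial transposition
  \<open>b = Suc n\<close>, or stands before some \<open>b\<close> in \<open>{1..n}\<close>.\<close>

lemma sum_permutes_Suc:
  "(\<Sum>p | p permutes {1..Suc n}. f p)
     = (\<Sum>p | p permutes {1..n}. f p + (\<Sum>b\<in>{1..n}. f (Transposition.transpose (Suc n) b \<circ> p)))"
proof -
  have "(\<Sum>p | p permutes {1..Suc n}. f p)
      = (\<Sum>b\<in>insert (Suc n) {1..n}. \<Sum>p | p permutes {1..n}. f (Transposition.transpose (Suc n) b \<circ> p))"
    using sum_over_permutations_insert[of "{1..n}" "Suc n" f] by (simp add: atLeastAtMostSuc_conv)
  also have "\<dots> = (\<Sum>p | p permutes {1..n}. f p)
      + (\<Sum>b\<in>{1..n}. \<Sum>p | p permutes {1..n}. f (Transposition.transpose (Suc n) b \<circ> p))"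
    by simp
  also have "(\<Sum>b\<in>{1..n}. \<Sum>p | p permutes {1..n}. f (Transposition.transpose (Suc n) b \<circ> p))
      = (\<Sum>p | p permutes {1..n}. \<Sum>b\<in>{1..n}. f (Transposition.transpose (Suc n) b \<circ> p))"
    by (rule sum.swap)
  finally show ?thesis by (simp only: sum.distrib)
qed

text \<open>Written in this way, the operator can be read as a count of insertions: those that keep
  the exponent \<open>m\<close> and those that raise it.\<close>

lemma recurrence_monom:
  fixes q a c :: "'a::field_char_0"
  shows "[:1, a:] * monom c m + smult (2 * q) ([:0, 1:] * [:1, -1:] * pderiv (monom c m))
    = monom c m + monom (2 * q * of_nat m * c) m + monom ((a - 2 * q * of_nat m) * c) (Suc m)"
proof -
  have "[:0, 1:] * pderiv (monom c m) = monom (of_nat m * c) m"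
    unfolding pderiv_monom by (cases m) (simp_all add: monom_Suc)
  then have *: "[:0, 1:] * [:1, -1:] * pderiv (monom c m) = [:1, -1:] * monom (of_nat m * c) m"
    by (metis mult.assoc mult.commute)
  show ?thesis unfolding *
    by (simp add: monom_Suc smult_monom smult_add_right algebra_simps add_monom[symmetric] minus_monom[symmetric] diff_monom[symmetric])
qed

lemma sum_monom_if:
  assumes "finite S" "T \<subseteq> S"
  shows "(\<Sum>b\<in>S. monom c (if b \<in> T then m else Suc m))
    = monom (of_nat (card T) * c) m + monom ((of_nat (card S) - of_nat (card T)) * (c :: 'a::field_char_0)) (Suc m)"
proof -
  have m: "(\<Sum>b\<in>U. monom c l) = monom (of_nat (card U) * c) l" for U :: "'b set" and l
    by (simp add: of_nat_poly smult_monom)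
  have "(\<Sum>b\<in>S. monom c (if b \<in> T then m else Suc m))
      = (\<Sum>b\<in>S - T. monom c (if b \<in> T then m else Suc m)) + (\<Sum>b\<in>T. monom c (if b \<in> T then m else Suc m))"
    by (rule sum.subset_diff[OF assms(2,1)])
  also have "\<dots> = monom (of_nat (card (S - T)) * c) (Suc m) + monom (of_nat (card T) * c) m"
    by (simp add: m del: sum_constant)
  also have "of_nat (card (S - T)) = (of_nat (card S) - of_nat (card T) :: 'a)"
    using assms by (simp add: card_Diff_subset finite_subset of_nat_diff card_mono)
  finally show ?thesis by (simp only: add.commute)
qed

section \<open>Cycle peaks under insertion\<close>

definition cpk_set :: "nat \<Rightarrow> (nat \<Rightarrow> nat) \<Rightarrow> nat set" where
  "cpk_set n p = {i \<in> {1..n}. inv p i < i \<and> i > p i}"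

lemma cpk_card: "cpk n p = card (cpk_set n p)"
  by (simp add: cpk_def cpk_set_def)

lemma permutes_Suc_fixed:
  assumes "p permutes {1..n}"
  shows "p (Suc n) = Suc n" "inv p (Suc n) = Suc n"
  using assms permutes_inv[OF assms] by (simp_all add: permutes_not_in)

lemma transpose_comp_apply:
  assumes "p permutes {1..n}" "i \<in> {1..n}"
  shows "(Transposition.transpose (Suc n) b \<circ> p) i = (if i = inv p b then Suc n else p i)"
proof -
  have "p i \<noteq> Suc n" using permutes_in_image[OF assms(1), of i] assms(2) by auto
  moreover have "p i = b \<longleftrightarrow> i = inv p b" using permutes_inv_eq[OF assms(1), of b i] by auto
  ultimately show ?thesis by (auto simp: Transposition.transpose_def)
qed

text \<open>The inserted maximum exceeds both its neighbours, so it is a peak and prevents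
  \<open>b\<close> and \<open>inv p b\<close> from being peaks; other elements keep their
  neighbours.\<close>

lemma cpk_set_transpose_comp:
  assumes p: "p permutes {1..n}" and b: "b \<in> {1..n}"
  shows "cpk_set (Suc n) (Transposition.transpose (Suc n) b \<circ> p)
    = insert (Suc n) (cpk_set n p - {b, inv p b})" (is "cpk_set _ ?g = _")
proof (rule set_eqI)
  fix i
  have bijp: "bij p" using p by (rule permutes_bij)
  have inv_g: "inv ?g = inv p \<circ> Transposition.transpose (Suc n) b"
    using bijp by (subst o_inv_distrib) auto
  have pb: "inv p b \<in> {1..n}" using permutes_in_image[OF permutes_inv[OF p], of b] b by auto
  show "i \<in> cpk_set (Suc n) ?g \<longleftrightarrow> i \<in> insert (Suc n) (cpk_set n p - {b, inv p b})"
  proof (cases "i \<in> {1..n}")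
    case True
    have "inv ?g i = (if i = b then Suc n else inv p i)"
      unfolding inv_g using True permutes_Suc_fixed[OF p] by (auto simp: Transposition.transpose_def)
    then show ?thesis using True transpose_comp_apply[OF p True, of b]
      by (auto simp: cpk_set_def)
  next
    case False
    have "inv ?g (Suc n) < Suc n" "?g (Suc n) < Suc n"
      unfolding inv_g using pb b permutes_Suc_fixed[OF p] by (auto simp: less_Suc_eq_le)
    then show ?thesis using False by (cases "i = Suc n") (auto simp: cpk_set_def)
  qed
qed

lemma cpk_set_Suc:
  assumes "p permutes {1..n}"
  shows "cpk_set (Suc n) p = cpk_set n p"
  using permutes_Suc_fixed[OF assms] by (auto simp: cpk_set_def le_Suc_eq)

text \<open>The successor of a peak is smaller than its predecessor, hence not a peak, so the union
  is disjoint. It consists of the insertion places that keep the number of peaks.\<close>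

lemma card_cpk_set_image:
  assumes p: "p permutes {1..n}"
  shows "card (cpk_set n p \<union> p ` cpk_set n p) = 2 * cpk n p"
proof -
  have inv: "inv p (p i) = i" for i using p by (simp add: permutes_inverses)
  have "cpk_set n p \<inter> p ` cpk_set n p = {}"
    by (auto simp: cpk_set_def inv)
  moreover have "finite (cpk_set n p)" by (simp add: cpk_set_def)
  moreover have "card (p ` cpk_set n p) = card (cpk_set n p)"
    using permutes_inj_on[OF p] by (rule card_image)
  ultimately show ?thesis by (simp add: card_Un_disjoint cpk_card)
qed

text \<open>One peak is gained, and at most one is lost because cyclically adjacent elements are
  never both peaks.\<close>

lemma cpk_transpose_comp:
  assumes p: "p permutes {1..n}" and b: "b \<in> {1..n}"
  shows "cpk (Suc n) (Transposition.transpose (Suc n) b \<circ> p)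
    = (if b \<in> cpk_set n p \<union> p ` cpk_set n p then cpk n p else Suc (cpk n p))"
proof -
  let ?P = "cpk_set n p" and ?c = "inv p b"
  have fin: "finite ?P" and sub: "Suc n \<notin> ?P" by (auto simp: cpk_set_def)
  have pc: "p ?c = b" using p by (simp add: permutes_inverses)
  have inv: "inv p (p i) = i" for i using p by (simp add: permutes_inverses)
  have im: "b \<in> p ` ?P \<longleftrightarrow> ?c \<in> ?P" using pc inv by force
  have "cpk (Suc n) (Transposition.transpose (Suc n) b \<circ> p) = Suc (card (?P - {b, ?c}))"
    unfolding cpk_card cpk_set_transpose_comp[OF p b] using fin sub by simp
  moreover have "b \<notin> ?P \<or> ?c \<notin> ?P" using pc by (auto simp: cpk_set_def)
  moreover have "Suc (card (?P - {z})) = card ?P" if "z \<in> ?P" for z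
    using that fin by (simp add: card.remove[symmetric] del: card_Diff_insert)
  moreover have "?P - {b, ?c} = (if b \<in> ?P then ?P - {b} else if ?c \<in> ?P then ?P - {?c} else ?P)"
    using calculation(2) by auto
  ultimately show ?thesis unfolding cpk_card Un_iff im by auto
qed

text \<open>A new fixed point keeps weight and peaks. Each of the \<open>n\<close> other insertions
  contributes a factor \<open>q\<close>, and \<open>2 * cpk n p\<close> of them keep the exponent,
  as in \<open>recurrence_monom\<close>.\<close>

theorem cpk_poly_eq_sum_permutes:
  fixes q :: "'a::field_char_0"
  shows "cpk_poly q n = (\<Sum>p | p permutes {1..n}. monom (q ^ (n - cycS n p)) (cpk n p))"
proof (induction n)
  case 0
  have "{p. p permutes {1..0::nat}} = {id}" by auto
  then show ?case by (simp add: cpk_def one_pCons[symmetric])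
next
  case (Suc n)
  let ?L = "\<lambda>r. [:1, of_nat n * q:] * r + smult (2 * q) ([:0, 1:] * [:1, -1:] * pderiv r)"
  have "cpk_poly q (Suc n) = (\<Sum>p | p permutes {1..n}. ?L (monom (q ^ (n - cycS n p)) (cpk n p)))"
    by (simp only: cpk_poly.simps Suc.IH pderiv_sum sum_distrib_left smult_sum_right sum.distrib)
  also have "\<dots> = (\<Sum>p | p permutes {1..n}. monom (q ^ (Suc n - cycS (Suc n) p)) (cpk (Suc n) p)
      + (\<Sum>b\<in>{1..n}. monom (q ^ (Suc n - cycS (Suc n) (Transposition.transpose (Suc n) b \<circ> p)))
          (cpk (Suc n) (Transposition.transpose (Suc n) b \<circ> p))))"
  proof (rule sum.cong[OF refl])
    fix p assume "p \<in> {p. p permutes {1..n}}"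
    then have p: "p permutes {1..n}" by simp
    let ?T = "cpk_set n p \<union> p ` cpk_set n p" and ?e = "q ^ (n - cycS n p)" and ?m = "cpk n p"
    have T: "?T \<subseteq> {1..n}"
      using permutes_in_image[OF p] by (auto simp: cpk_set_def simp del: atLeastAtMost_iff)
    \<comment> \<open>The bound on the number of cycles keeps the natural subtraction exact.\<close>
    have "Suc n - cycS n p = Suc (n - cycS n p)" using cycS_le[of n p] by simp
    then have "(\<Sum>b\<in>{1..n}. monom (q ^ (Suc n - cycS (Suc n) (Transposition.transpose (Suc n) b \<circ> p)))
          (cpk (Suc n) (Transposition.transpose (Suc n) b \<circ> p)))
       = (\<Sum>b\<in>{1..n}. monom (q * ?e) (if b \<in> ?T then ?m else Suc ?m))"
      by (intro sum.cong refl) (simp only: cycS_transpose_comp[OF p] cpk_transpose_comp[OF p] power_Suc)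
    also have "\<dots> = monom (of_nat (2 * ?m) * (q * ?e)) ?m + monom ((of_nat n - of_nat (2 * ?m)) * (q * ?e)) (Suc ?m)"
      using sum_monom_if[OF _ T, of "q * ?e" ?m] by (simp add: card_cpk_set_image[OF p])
    finally show "?L (monom ?e ?m) = monom (q ^ (Suc n - cycS (Suc n) p)) (cpk (Suc n) p)
      + (\<Sum>b\<in>{1..n}. monom (q ^ (Suc n - cycS (Suc n) (Transposition.transpose (Suc n) b \<circ> p)))
          (cpk (Suc n) (Transposition.transpose (Suc n) b \<circ> p)))"
      unfolding recurrence_monom by (simp add: cycS_Suc[OF p] cpk_card cpk_set_Suc[OF p] algebra_simps)
  qed
  finally show ?case unfolding sum_permutes_Suc .
qed


section \<open>Signed permutations\<close>

text \<open>A signed permutation is encoded by the permutation of absolute values together with the set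
  of absolute values that occur with a negative sign.\<close>
definition signed_val :: "nat set \<Rightarrow> nat \<Rightarrow> int" where
  "signed_val A j = (if j \<in> A then - int j else int j)"

lemma abs_signed_val [simp]: "\<bar>signed_val A j\<bar> = int j"
  by (simp add: signed_val_def)

text \<open>Excedances are recorded by the absolute value \<open>j\<close> of \<open>w(i)\<close>
  rather than by the position \<open>i\<close>; then \<open>w(i)\<close> is
  \<open>signed_val A j\<close> and its successor is \<open>signed_val A (p j)\<close>.\<close>

definition exc_set :: "nat \<Rightarrow> (nat \<Rightarrow> nat) \<Rightarrow> nat set \<Rightarrow> nat set" where
  "exc_set n p A = {j \<in> {1..n}. signed_val A j < signed_val A (p j) \<or> p j = j \<and> j \<notin> A}"

lemma exc_set_Suc:
  assumes p: "p permutes {1..n}" and A: "A \<subseteq> {1..n}"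
  shows "exc_set (Suc n) p A = insert (Suc n) (exc_set n p A)"
    and "exc_set (Suc n) p (insert (Suc n) A) = exc_set n p A"
proof -
  note fixed = permutes_Suc_fixed[OF p]
  have "Suc n \<notin> A" using A by auto
  then show "exc_set (Suc n) p A = insert (Suc n) (exc_set n p A)"
    using fixed by (auto simp: exc_set_def le_Suc_eq)
  have "p j \<noteq> Suc n" if "j \<in> {1..n}" for j
    using permutes_in_image[OF p, of j] that by auto
  then show "exc_set (Suc n) p (insert (Suc n) A) = exc_set n p A"
    using fixed by (auto simp: exc_set_def le_Suc_eq signed_val_def split: if_splits)
qed

text \<open>A positive new maximum makes its predecessor \<open>inv p b\<close> an excedance without
  being one; a negative one is an excedance and its predecessor is not. Both sets have the same
  size.\<close>

lemma exc_set_transpose_comp: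
  assumes p: "p permutes {1..n}" and b: "b \<in> {1..n}" and A: "A \<subseteq> {1..n}"
  shows "exc_set (Suc n) (Transposition.transpose (Suc n) b \<circ> p) A
      = insert (inv p b) (exc_set n p A)" (is "exc_set _ ?g _ = _")
    and "exc_set (Suc n) (Transposition.transpose (Suc n) b \<circ> p) (insert (Suc n) A)
      = insert (Suc n) (exc_set n p A - {inv p b})"
proof -
  have pb: "inv p b \<in> {1..n}" using permutes_in_image[OF permutes_inv[OF p], of b] b by auto
  have gM: "?g (Suc n) = b" using permutes_Suc_fixed[OF p] by simp
  have MA: "Suc n \<notin> A" using A by auto
  have bound: "- int (Suc n) < signed_val A j \<and> signed_val A j < int (Suc n)" if "j \<in> {1..n}" for j
    using that by (simp add: signed_val_def)
  have val: "signed_val (insert (Suc n) A) j = signed_val A j" if "j \<in> {1..n}" for j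
    using that by (auto simp: signed_val_def)
  have M1: "signed_val A (Suc n) = int (Suc n)" and M2: "signed_val (insert (Suc n) A) (Suc n) = - int (Suc n)"
    using MA by (auto simp: signed_val_def)
  have p_in: "p j \<in> {1..n}" if "j \<in> {1..n}" for j using permutes_in_image[OF p, of j] that by auto
  show "exc_set (Suc n) ?g A = insert (inv p b) (exc_set n p A)"
  proof (rule set_eqI)
    fix j
    consider "j = Suc n" | "j \<in> {1..n}" "j = inv p b" | "j \<in> {1..n}" "j \<noteq> inv p b" | "j \<notin> {1..Suc n}"
      by (cases "j \<in> {1..n}") (auto simp: le_Suc_eq)
    then show "j \<in> exc_set (Suc n) ?g A \<longleftrightarrow> j \<in> insert (inv p b) (exc_set n p A)"
    proof cases
      case 1
      then show ?thesis using gM M1 bound[OF b] pb b by (auto simp: exc_set_def)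
    next
      case 2
      then have "?g j = Suc n" using transpose_comp_apply[OF p 2(1), of b] by simp
      then show ?thesis using 2 M1 bound[OF 2(1)] by (auto simp: exc_set_def)
    next
      case 3
      then have "?g j = p j" using transpose_comp_apply[OF p 3(1), of b] by simp
      then show ?thesis using 3 by (auto simp: exc_set_def)
    next
      case 4
      then show ?thesis using pb by (auto simp: exc_set_def)
    qed
  qed
  show "exc_set (Suc n) ?g (insert (Suc n) A) = insert (Suc n) (exc_set n p A - {inv p b})"
  proof (rule set_eqI)
    fix j
    consider "j = Suc n" | "j \<in> {1..n}" "j = inv p b" | "j \<in> {1..n}" "j \<noteq> inv p b" | "j \<notin> {1..Suc n}"
      by (cases "j \<in> {1..n}") (auto simp: le_Suc_eq)
    then show "j \<in> exc_set (Suc n) ?g (insert (Suc n) A) \<longleftrightarrow> j \<in> insert (Suc n) (exc_set n p A - {inv p b})"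
    proof cases
      case 1
      then show ?thesis using gM M2 bound[OF b] val[OF b] by (auto simp: exc_set_def)
    next
      case 2
      then have "?g j = Suc n" using transpose_comp_apply[OF p 2(1), of b] by simp
      then show ?thesis using 2 M2 bound[OF 2(1)] val[OF 2(1)] by (auto simp: exc_set_def)
    next
      case 3
      then have "?g j = p j" using transpose_comp_apply[OF p 3(1), of b] by simp
      then show ?thesis using 3 val[OF 3(1)] val[OF p_in[OF 3(1)]] by (auto simp: exc_set_def)
    next
      case 4
      then show ?thesis by (auto simp: exc_set_def)
    qed
  qed
qed

section \<open>Excedance polynomials by signed insertion\<close>

lemma sum_Pow_insert:
  assumes "finite S" "x \<notin> S"
  shows "(\<Sum>A\<in>Pow (insert x S). f A) = (\<Sum>A\<in>Pow S. f A + f (insert x A))"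
proof -
  have "inj_on (insert x) (Pow S)" using assms(2) by (auto simp: inj_on_def)
  moreover have "Pow S \<inter> insert x ` Pow S = {}" using assms(2) by auto
  ultimately show ?thesis using assms(1)
    by (simp add: Pow_insert sum.union_disjoint sum.reindex sum.distrib)
qed

text \<open>As a fixed point the new element adds an excedance only if positive, which gives
  \<open>1 + x\<close>. Elsewhere both signs have equal effect, which gives the factor
  \<open>2 * k\<close>.\<close>

lemma gamma_poly_eq_sum_permutes:
  fixes k :: "'a::field_char_0"
  shows "gamma_poly k n = (\<Sum>p | p permutes {1..n}. \<Sum>A\<in>Pow {1..n}.
     monom (k ^ (n - cycS n p)) (card (exc_set n p A)))"
proof (induction n)
  case 0
  have "{p. p permutes {1..0::nat}} = {id}" by auto
  then show ?case by (simp add: gamma_poly_0 exc_set_def one_pCons[symmetric])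
next
  case (Suc n)
  let ?L = "\<lambda>r. [:1, 1 + 2 * k * of_nat n:] * r + smult (2 * k) ([:0, 1:] * [:1, -1:] * pderiv r)"
  let ?t = "Transposition.transpose (Suc n)"
  let ?f = "\<lambda>p A. monom (k ^ (Suc n - cycS (Suc n) p)) (card (exc_set (Suc n) p A))"
  have "gamma_poly k (Suc n) = (\<Sum>p | p permutes {1..n}. \<Sum>A\<in>Pow {1..n}.
      ?L (monom (k ^ (n - cycS n p)) (card (exc_set n p A))))"
    by (simp only: gamma_poly_Suc Suc.IH pderiv_sum sum_distrib_left smult_sum_right sum.distrib)
  also have "\<dots> = (\<Sum>p | p permutes {1..n}. \<Sum>A\<in>Pow {1..n}. (?f p A + ?f p (insert (Suc n) A))
      + (\<Sum>b\<in>{1..n}. ?f (?t b \<circ> p) A + ?f (?t b \<circ> p) (insert (Suc n) A)))"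
  proof (intro sum.cong refl)
    fix p A assume "p \<in> {p. p permutes {1..n}}" and "A \<in> Pow {1..n}"
    then have p: "p permutes {1..n}" and A: "A \<subseteq> {1..n}" by auto
    let ?E = "exc_set n p A" and ?e = "k ^ (n - cycS n p)"
    let ?m = "card ?E"
    have E: "?E \<subseteq> {1..n}" and fin: "finite ?E" and M: "Suc n \<notin> ?E" by (auto simp: exc_set_def)
    have e: "k ^ (Suc n - cycS n p) = k * ?e" using cycS_le[of n p] by (simp add: Suc_diff_le)
    have c1: "card (insert c ?E) = (if c \<in> ?E then ?m else Suc ?m)" for c
      using fin by (simp add: insert_absorb)
    have c2: "card (insert (Suc n) (?E - {c})) = (if c \<in> ?E then ?m else Suc ?m)" for c
      using fin M card_Suc_Diff1[OF fin, of c] by (simp del: card_Diff_insert)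
    \<comment> \<open>The effect depends on the predecessor \<open>c = inv p b\<close>, so the sum
      over \<open>b\<close> is reindexed by \<open>c\<close>.\<close>
    have bij: "bij_betw (inv p) {1..n} {1..n}"
      using permutes_inv[OF p] by (rule permutes_imp_bij)
    have "(\<Sum>b\<in>{1..n}. ?f (?t b \<circ> p) A + ?f (?t b \<circ> p) (insert (Suc n) A))
        = (\<Sum>b\<in>{1..n}. (\<lambda>c. monom (k * ?e) (if c \<in> ?E then ?m else Suc ?m)
            + monom (k * ?e) (if c \<in> ?E then ?m else Suc ?m)) (inv p b))"
      by (intro sum.cong refl)
         (simp only: cycS_transpose_comp[OF p] exc_set_transpose_comp[OF p _ A] c1 c2 e)
    also have "\<dots> = (\<Sum>c\<in>{1..n}. monom (k * ?e) (if c \<in> ?E then ?m else Suc ?m)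
            + monom (k * ?e) (if c \<in> ?E then ?m else Suc ?m))"
      by (rule sum.reindex_bij_betw[OF bij])
    also have "\<dots> = monom (of_nat ?m * (2 * (k * ?e))) ?m + monom ((of_nat n - of_nat ?m) * (2 * (k * ?e))) (Suc ?m)"
      using sum_monom_if[OF _ E, of "2 * (k * ?e)" ?m] by (simp add: add_monom)
    finally show "?L (monom ?e ?m) = (?f p A + ?f p (insert (Suc n) A))
        + (\<Sum>b\<in>{1..n}. ?f (?t b \<circ> p) A + ?f (?t b \<circ> p) (insert (Suc n) A))"
      unfolding recurrence_monom cycS_Suc[OF p] exc_set_Suc[OF p A]
      using fin M by (simp add: algebra_simps add_monom[symmetric] diff_monom[symmetric])
  qed
  also have "\<dots> = (\<Sum>p | p permutes {1..n}. (\<Sum>A\<in>Pow {1..Suc n}. ?f p A)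
      + (\<Sum>b\<in>{1..n}. \<Sum>A\<in>Pow {1..Suc n}. ?f (?t b \<circ> p) A))"
  proof (rule sum.cong[OF refl])
    fix p
    have Pow: "(\<Sum>A\<in>Pow {1..Suc n}. h A) = (\<Sum>A\<in>Pow {1..n}. h A + h (insert (Suc n) A))"
      for h :: "nat set \<Rightarrow> 'a poly"
      using sum_Pow_insert[of "{1..n}" "Suc n" h] by (simp add: atLeastAtMostSuc_conv)
    show "(\<Sum>A\<in>Pow {1..n}. (?f p A + ?f p (insert (Suc n) A))
      + (\<Sum>b\<in>{1..n}. ?f (?t b \<circ> p) A + ?f (?t b \<circ> p) (insert (Suc n) A)))
     = (\<Sum>A\<in>Pow {1..Suc n}. ?f p A) + (\<Sum>b\<in>{1..n}. \<Sum>A\<in>Pow {1..Suc n}. ?f (?t b \<circ> p) A)"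
      unfolding Pow by (subst sum.distrib, subst sum.swap) (rule refl)
  qed
  finally show ?case unfolding sum_permutes_Suc .
qed

section \<open>Signed permutations as pairs of a permutation and a sign set\<close>

definition signed_perm_of :: "nat \<Rightarrow> (nat \<Rightarrow> nat) \<Rightarrow> nat set \<Rightarrow> int \<Rightarrow> int" where
  "signed_perm_of n p A i = (if i \<in> {- int n..int n} - {0} then sgn i * signed_val A (p (nat \<bar>i\<bar>)) else i)"

lemma signed_perm_of_int:
  "m \<in> {1..n} \<Longrightarrow> signed_perm_of n p A (int m) = signed_val A (p m)"
  by (simp add: signed_perm_of_def)

lemma signed_perm_of_in_signed_perms:
  assumes p: "p permutes {1..n}"
  shows "signed_perm_of n p A \<in> signed_perms n"
proof -
  let ?w = "signed_perm_of n p A" and ?S = "{- int n..int n} - {0}"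
  have odd: "?w (- i) = - ?w i" for i by (auto simp: signed_perm_of_def)
  have p_in: "p (nat \<bar>i\<bar>) \<in> {1..n}" if "i \<in> ?S" for i
    using permutes_in_image[OF p, of "nat \<bar>i\<bar>"] that by auto
  have abs: "\<bar>?w i\<bar> = int (p (nat \<bar>i\<bar>))" if "i \<in> ?S" for i
    using that by (simp add: signed_perm_of_def abs_mult)
  have "inj_on ?w ?S"
  proof (rule inj_onI)
    fix i j assume i: "i \<in> ?S" and j: "j \<in> ?S" and eq: "?w i = ?w j"
    then have "p (nat \<bar>i\<bar>) = p (nat \<bar>j\<bar>)" using abs[OF i] abs[OF j] by simp
    then have ij: "nat \<bar>i\<bar> = nat \<bar>j\<bar>" using permutes_inj[OF p] by (auto dest: injD)
    moreover have "signed_val A (p (nat \<bar>j\<bar>)) \<noteq> 0"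
      using p_in[OF j] by (auto simp: signed_val_def)
    ultimately have "sgn i = sgn j" using eq i j by (simp add: signed_perm_of_def)
    with ij show "i = j" by (metis abs_ge_zero nat_0_le sgn_mult_abs)
  qed
  moreover have "?w ` ?S \<subseteq> ?S"
  proof
    fix z assume "z \<in> ?w ` ?S"
    then obtain i where "i \<in> ?S" "z = ?w i" by (rule imageE)
    then show "z \<in> ?S" using abs[of i] p_in[of i] by auto
  qed
  ultimately have "bij_betw ?w ?S ?S"
    by (simp add: bij_betw_def endo_inj_surj)
  then have "?w permutes ?S" by (rule bij_imp_permutes) (auto simp: signed_perm_of_def)
  then show ?thesis using odd by (simp add: signed_perms_def)
qed

text \<open>The condition at position \<open>m\<close> is the one recorded in \<open>exc_set\<close>
  at the value \<open>p m\<close>, and \<open>p\<close> is a bijection.\<close>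

lemma wexc_signed_perm_of:
  assumes p: "p permutes {1..n}"
  shows "wexc n (signed_perm_of n p A) = card (exc_set n p A)"
proof -
  let ?w = "signed_perm_of n p A"
  let ?I = "{m \<in> {1..n}. p m \<in> exc_set n p A}"
  have p_in: "p m \<in> {1..n}" if "m \<in> {1..n}" for m using permutes_in_image[OF p, of m] that by auto
  have iff: "(?w (int m) = int m \<or> ?w \<bar>?w (int m)\<bar> > ?w (int m)) \<longleftrightarrow> p m \<in> exc_set n p A"
    if m: "m \<in> {1..n}" for m
  proof -
    have 1: "?w (int m) = signed_val A (p m)" using m by (rule signed_perm_of_int)
    have 2: "?w \<bar>signed_val A (p m)\<bar> = signed_val A (p (p m))"
      using p_in[OF m] by (simp only: abs_signed_val signed_perm_of_int)
    have "signed_val A (p m) = int m \<longleftrightarrow> p (p m) = p m \<and> p m \<notin> A"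
      using m p_in[OF m] permutes_inj[OF p] by (auto simp: signed_val_def inj_eq)
    then show ?thesis unfolding 1 2 using p_in[OF m] by (auto simp: exc_set_def)
  qed
  have "{i \<in> {1..int n}. ?w i = i \<or> ?w \<bar>?w i\<bar> > ?w i} = int ` ?I"
  proof (rule set_eqI)
    fix i
    show "i \<in> {i \<in> {1..int n}. ?w i = i \<or> ?w \<bar>?w i\<bar> > ?w i} \<longleftrightarrow> i \<in> int ` ?I"
    proof (cases "i \<in> {1..int n}")
      case True
      then have "i = int (nat i)" "nat i \<in> {1..n}" by auto
      then obtain m where "i = int m" "m \<in> {1..n}" by blast
      then show ?thesis using iff[of m] by auto
    qed auto
  qed
  then have "wexc n ?w = card (int ` ?I)" by (simp add: wexc_def)
  also have "\<dots> = card ?I" by (simp add: card_image)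
  also have "\<dots> = card (p ` ?I)" using permutes_inj_on[OF p] by (simp add: card_image)
  also have "p ` ?I = exc_set n p A"
  proof -
    have "exc_set n p A \<subseteq> p ` {1..n}" unfolding permutes_image[OF p] by (auto simp: exc_set_def)
    then show ?thesis by blast
  qed
  finally show ?thesis .
qed

text \<open>On \<open>{1..int n}\<close> the absolute value of the signed permutation is
  \<open>p\<close> transported along \<open>int\<close>, so orbits correspond.\<close>

lemma cycB_signed_perm_of:
  assumes p: "p permutes {1..n}"
  shows "cycB n (signed_perm_of n p A) = cycS n p"
proof -
  let ?g = "\<lambda>i. \<bar>signed_perm_of n p A i\<bar>"
  have g: "?g (int m) = int (p m)" if "m \<in> {1..n}" for m
    using that by (simp add: signed_perm_of_int)
  have orb: "orbit ?g (int m) = int ` orbit p m" if m: "m \<in> {1..n}" for m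
  proof -
    have sub: "orbit p m \<subseteq> {1..n}" using p m by (rule permutes_orbit_subset)
    show ?thesis
    proof (rule equalityI; rule subsetI)
      fix i assume "i \<in> orbit ?g (int m)"
      then show "i \<in> int ` orbit p m"
      proof induction
        case base
        then show ?case unfolding g[OF m] by (intro imageI orbit.base)
      next
        case (step i)
        then obtain l where l: "i = int l" "l \<in> orbit p m" by auto
        then have "?g i = int (p l)" using sub by (auto intro!: g)
        then show ?case using orbit.step[OF l(2)] by simp
      qed
    next
      fix i assume "i \<in> int ` orbit p m"
      then obtain l where l: "i = int l" "l \<in> orbit p m" by auto
      from l(2) have "int l \<in> orbit ?g (int m)"
      proof induction
        case base
        then show ?case using orbit.base[of ?g "int m"] unfolding g[OF m] .
      next
        case (step l)
        then have "?g (int l) = int (p l)" using sub by (intro g) auto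
        then show ?case using orbit.step[OF step.IH] by simp
      qed
      then show "i \<in> orbit ?g (int m)" using l by simp
    qed
  qed
  have "{1..int n} = int ` {1..n}" by (simp add: image_int_atLeastAtMost)
  then have "(\<lambda>x. orbit ?g x) ` {1..int n} = (\<lambda>m. orbit ?g (int m)) ` {1..n}"
    by (simp only: image_image)
  also have "\<dots> = (\<lambda>m. int ` orbit p m) ` {1..n}" by (rule image_cong[OF refl orb])
  also have "\<dots> = image int ` (\<lambda>m. orbit p m) ` {1..n}" by (simp only: image_image)
  finally have "cycB n (signed_perm_of n p A) = card (image int ` (\<lambda>m. orbit p m) ` {1..n})"
    by (simp only: cycB_def num_cycles_def)
  also have "\<dots> = cycS n p"
    unfolding cycS_def num_cycles_def
    by (rule card_image) (auto intro!: inj_onI simp: inj_image_eq_iff)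
  finally show ?thesis .
qed

lemma bij_betw_signed_perm_of:
  "bij_betw (\<lambda>(p, A). signed_perm_of n p A) ({p. p permutes {1..n}} \<times> Pow {1..n}) (signed_perms n)"
proof (rule bij_betw_imageI)
  show "inj_on (\<lambda>(p, A). signed_perm_of n p A) ({p. p permutes {1..n}} \<times> Pow {1..n})"
  proof (rule inj_onI, clarsimp, rule conjI)
    fix p q A B assume p: "p permutes {Suc 0..n}" and q: "q permutes {Suc 0..n}"
      and A: "A \<subseteq> {Suc 0..n}" and B: "B \<subseteq> {Suc 0..n}"
      and eq: "signed_perm_of n p A = signed_perm_of n q B"
    have val: "signed_val A (p m) = signed_val B (q m)" if "m \<in> {1..n}" for m
      using signed_perm_of_int[OF that, of p A] signed_perm_of_int[OF that, of q B] eq by simp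
    show pq: "p = q"
    proof
      fix m show "p m = q m"
      proof (cases "m \<in> {1..n}")
        case True
        then show ?thesis using arg_cong[OF val[OF True], of abs] by simp
      next
        case False
        then show ?thesis using p q by (simp add: permutes_not_in)
      qed
    qed
    have "j \<in> A \<longleftrightarrow> j \<in> B" if "j \<in> {1..n}" for j
    proof -
      have "j \<in> p ` {1..n}" using permutes_image[OF p] that by simp
      then obtain m where "m \<in> {1..n}" "p m = j" by auto
      with val[of m] pq that show ?thesis by (auto simp: signed_val_def split: if_splits)
    qed
    then show "A = B" using A B by auto
  qed
  show "(\<lambda>(p, A). signed_perm_of n p A) ` ({p. p permutes {1..n}} \<times> Pow {1..n}) = signed_perms n"
  proof (rule equalityI; rule subsetI)
    fix w assume w: "w \<in> signed_perms n"
    let ?S = "{- int n..int n} - {0}"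
    have wS: "w permutes ?S" and odd: "w (- i) = - w i" for i
      using w by (auto simp: signed_perms_def)
    \<comment> \<open>The inverse encoding: \<open>p\<close> takes absolute values, and
      \<open>A\<close> collects the absolute values of the negative images of
      \<open>1..n\<close>.\<close>
    define p where "p = (\<lambda>j. if j \<in> {1..n} then nat \<bar>w (int j)\<bar> else j)"
    define A where "A = {j \<in> {1..n}. \<exists>m \<in> {1..n}. w (int m) = - int j}"
    have inj: "w i = w j \<Longrightarrow> i = j" for i j using permutes_inj[OF wS] by (auto dest: injD)
    have w_in: "w (int j) \<in> ?S" if "j \<in> {1..n}" for j
      using permutes_in_image[OF wS, of "int j"] that by auto
    have "inj_on p {1..n}"
    proof (rule inj_onI)
      fix i j assume i: "i \<in> {1..n}" and j: "j \<in> {1..n}" and "p i = p j"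
      then have "\<bar>w (int i)\<bar> = \<bar>w (int j)\<bar>" by (simp add: p_def)
      then have "w (int i) = w (int j) \<or> w (int i) = w (- int j)" unfolding odd by linarith
      then have "int i = int j \<or> int i = - int j" using inj by blast
      then show "i = j" using i j by auto
    qed
    moreover have "p ` {1..n} \<subseteq> {1..n}" using w_in by (force simp: p_def)
    ultimately have "bij_betw p {1..n} {1..n}"
      by (simp add: bij_betw_def endo_inj_surj)
    then have p: "p permutes {1..n}" by (rule bij_imp_permutes) (auto simp: p_def)
    have val: "signed_val A (p m) = w (int m)" if m: "m \<in> {1..n}" for m
    proof (cases "w (int m) < 0")
      case True
      then have "p m \<in> A" using m w_in[OF m] by (auto simp: p_def A_def intro!: bexI[of _ m])
      then show ?thesis using True m by (simp add: signed_val_def p_def)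
    next
      case False
      \<comment> \<open>Otherwise some positive \<open>l\<close> has
        \<open>w(l) = -w(m) = w(-m)\<close>, which contradicts injectivity.\<close>
      have "p m \<notin> A"
      proof
        assume "p m \<in> A"
        then obtain l where l: "l \<in> {1..n}" "w (int l) = - int (p m)" by (auto simp: A_def)
        then have "w (int l) = w (- int m)" unfolding odd using False m by (simp add: p_def)
        then have "int l = - int m" by (rule inj)
        then show False using l m by auto
      qed
      then show ?thesis using False m by (simp add: signed_val_def p_def)
    qed
    have "signed_perm_of n p A = w"
    proof
      fix i
      consider "i \<notin> ?S" | m where "m \<in> {1..n}" "i = int m" | m where "m \<in> {1..n}" "i = - int m"
      proof (cases "i \<in> ?S")
        case True
        then have "nat \<bar>i\<bar> \<in> {1..n}" "i = int (nat \<bar>i\<bar>) \<or> i = - int (nat \<bar>i\<bar>)" by auto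
        then show ?thesis using that by blast
      qed (use that in blast)
      then show "signed_perm_of n p A i = w i"
      proof cases
        case 1
        then show ?thesis using permutes_not_in[OF wS 1] by (auto simp: signed_perm_of_def)
      next
        case 2
        then show ?thesis using val[of m] by (simp add: signed_perm_of_def)
      next
        case 3
        then show ?thesis using val[of m] odd[of "int m"] by (simp add: signed_perm_of_def)
      qed
    qed
    moreover have "A \<subseteq> {1..n}" by (auto simp: A_def)
    ultimately show "w \<in> (\<lambda>(p, A). signed_perm_of n p A) ` ({p. p permutes {1..n}} \<times> Pow {1..n})"
      using p by (auto intro!: image_eqI[of _ _ "(p, A)"])
  qed (auto intro: signed_perm_of_in_signed_perms)
qed

lemma gamma_poly_eq_sum_signed_perms:
  "gamma_poly k n = (\<Sum>w\<in>signed_perms n. monom (k ^ (n - cycB n w)) (wexc n w))"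
proof -
  have "(\<Sum>w\<in>signed_perms n. monom (k ^ (n - cycB n w)) (wexc n w))
      = (\<Sum>(p, A)\<in>{p. p permutes {1..n}} \<times> Pow {1..n}.
           monom (k ^ (n - cycB n (signed_perm_of n p A))) (wexc n (signed_perm_of n p A)))"
    using sum.reindex_bij_betw[OF bij_betw_signed_perm_of, symmetric]
    by (simp add: case_prod_unfold)
  also have "\<dots> = (\<Sum>(p, A)\<in>{p. p permutes {1..n}} \<times> Pow {1..n}.
           monom (k ^ (n - cycS n p)) (card (exc_set n p A)))"
    by (intro sum.cong refl) (auto simp: cycB_signed_perm_of wexc_signed_perm_of)
  finally show ?thesis by (simp add: gamma_poly_eq_sum_permutes sum.cartesian_product)
qed

text \<open>\<open>Bk k n\<close> lies in the fraction field, so statements about derivatives and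
  \<open>gamma_positive\<close> refer to a polynomial that \<open>to_fract\<close> maps to it; this
  polynomial is unique because \<open>to_fract\<close> is injective.\<close>

theorem theorem2:
  fixes k :: real
  assumes "k > 0"
  shows "(\<forall>n\<ge>1. Bk k n =
            to_fract (\<Sum>w\<in>signed_perms n. monom (k ^ (n - cycB n w)) (wexc n w)))
   \<and> Bk k 0 = 1 \<and> Bk k 1 = to_fract [:1, 1:]
   \<and> (\<forall>n. \<exists>p r. Bk k n = to_fract p \<and> Bk k (Suc n) = to_fract r \<and>
         r = [:1, 1 + 2 * k * real n:] * p + smult (2 * k) ([:0, 1:] * [:1, -1:] * pderiv p))
   \<and> (\<forall>n. \<exists>p. Bk k n = to_fract p \<and> gamma_positive n p)
   \<and> (\<forall>n\<ge>1. Bk k n = to_fract (\<Sum>i = 0..n div 2.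
         smult (\<Sum>j = i..n - 1. of_int (bcoef n (int i) (int j)) * k ^ j * 4 ^ i)
               ([:0, 1:] ^ i * [:1, 1:] ^ (n - 2 * i))))
   \<and> (\<forall>n. \<forall>x q :: complex.
         bpoly n x q = (\<Sum>\<pi> | \<pi> permutes {1..n}. x ^ cpk n \<pi> * q ^ (n - cycS n \<pi>)))
   \<and> (\<forall>x q :: complex. x \<noteq> 1 \<and> q \<noteq> 0 \<longrightarrow>
         Abs_fps (\<lambda>n. bpoly n x q / fact n) = b_egf_rhs x q)"
proof (intro conjI allI impI)
  note Bk = Bk_eq_gamma_poly[OF assms]
  fix n :: nat
  show "Bk k n = to_fract (\<Sum>w\<in>signed_perms n. monom (k ^ (n - cycB n w)) (wexc n w))"
    unfolding Bk gamma_poly_eq_sum_signed_perms ..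
  show "Bk k 0 = 1" by (simp add: Bk gamma_poly_0)
  show "Bk k 1 = to_fract [:1, 1:]"
    unfolding Bk One_nat_def gamma_poly_Suc gamma_poly_0 by (simp add: one_pCons[symmetric])
  show "\<exists>p r. Bk k n = to_fract p \<and> Bk k (Suc n) = to_fract r \<and>
      r = [:1, 1 + 2 * k * real n:] * p + smult (2 * k) ([:0, 1:] * [:1, -1:] * pderiv p)"
    using Bk gamma_poly_Suc[of k n] by blast
  \<comment> \<open>Positivity is read off from the sum over permutations, where each weight is a
    power of \<open>k > 0\<close>.\<close>
  have "0 \<le> coeff (cpk_poly k n) i" for i
    unfolding cpk_poly_eq_sum_permutes coeff_sum using assms by (intro sum_nonneg) simp
  then show "\<exists>p. Bk k n = to_fract p \<and> gamma_positive n p"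
    using Bk[of n] unfolding gamma_positive_def gamma_poly_def
    by (intro exI[of _ "gamma_poly k n"] conjI exI[of _ "\<lambda>i. coeff (cpk_poly k n) i * 4 ^ i"])
       (auto simp: gamma_poly_def)
  show "Bk k n = to_fract (\<Sum>i = 0..n div 2.
      smult (\<Sum>j = i..n - 1. of_int (bcoef n (int i) (int j)) * k ^ j * 4 ^ i)
        ([:0, 1:] ^ i * [:1, 1:] ^ (n - 2 * i)))" if "1 \<le> n"
    unfolding Bk gamma_poly_def coeff_cpk_poly_bcoef[OF that] sum_distrib_right ..
  fix x q :: complex
  show "bpoly n x q = (\<Sum>\<pi> | \<pi> permutes {1..n}. x ^ cpk n \<pi> * q ^ (n - cycS n \<pi>))"
    by (simp add: bpoly_eq_poly cpk_poly_eq_sum_permutes poly_sum poly_monom mult.commute)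
  show "Abs_fps (\<lambda>n. bpoly n x q / fact n) = b_egf_rhs x q" if "x \<noteq> 1 \<and> q \<noteq> 0"
    using that by (simp add: b_egf_rhs_eq)
qed

end
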